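(* Let $d\ge1$, $r\ge0$, $0<\sigma\le1$ and $\alpha\in(0,1)\cup(1,\infty)$. There is a universal constant $C>0$ such that for all $n\in\mathbb{N}$, $z\ge0$ and all $\mu,\nu\in\mathcal{P}(\mathbb{B}_d(r))$, if $X_1,\dots,X_n$ are i.i.d. $\sim\mu$, $Y_1,\dots,Y_n$ i.i.d. $\sim\nu$ with empirical measures $\hat\mu_n,\hat\nu_n$, then $$\mathbb{P}\Big(\big|\mathsf{D}_\alpha(\hat\mu_n*\gamma_\sigma\|\hat\nu_n*\gamma_\sigma)-\mathsf{D}_\alpha(\mu*\gamma_\sigma\|\nu*\gamma_\sigma)\big|\ge C\,\lambda_{\alpha,d,r,\sigma}\big(\tilde\xi_{r,d,\sigma}n^{-1/2}+z\big)\Big)\le 2e^{-(nz^2\wedge nz)},$$ where $\tilde\xi_{r,d,\sigma}:=(3ed)^{3(d+2)}(r+1)^{\frac d2+1}\sigma^{-\frac d2}$, $b_{r,\sigma}:=\frac{r^2+4r}{\sigma^2}$ and $$\lambda_{\alpha,d,r,\sigma}:=\Big(\frac{\alpha}{|\alpha-1|}+1\Big)\exp\!\Big((\alpha+1)b_{r,\sigma}\Big(1+r+\frac{\sqrt d\sigma}{2}+d(\alpha+1)b_{r,\sigma}\sigma^2\Big)\Big).$$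
   Context: $\gamma_\sigma=N(0,\sigma^2I_d)$; $*$ is convolution; $\mathcal{P}(\mathbb{B}_d(r))$ is the set of Borel probability measures on $\mathbb{R}^d$ supported in the closed Euclidean ball of radius $r$. For $\alpha\in(0,1)\cup(1,\infty)$, the Rényi divergence is $\mathsf{D}_\alpha(\mu\|\nu)=\frac{1}{\alpha-1}\log\int p_\mu^\alpha p_\nu^{1-\alpha}d\rho$ if $\mu\ll\nu$ (or, for $\alpha\in(0,1)$, $\mu,\nu$ not mutually singular), and $+\infty$ otherwise, where $p_\mu,p_\nu$ are densities w.r.t. a $\sigma$-finite $\rho$ dominating both. *)

theory Defs
  imports "HOL-Probability.Probability"
begin

text \<open>Euclidean space R^d is represented explicitly (so that d can be quantified
inside the formula) as functions nat => real restricted to {..<d}, with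
Lebesgue measure the product of d copies of lborel.\<close>

definition leb :: "nat \<Rightarrow> (nat \<Rightarrow> real) measure" where
  "leb d = PiM {..<d} (\<lambda>_. lborel)"

definition borel_d :: "nat \<Rightarrow> (nat \<Rightarrow> real) measure" where
  "borel_d d = PiM {..<d} (\<lambda>_. borel)"

definition enorm_d :: "nat \<Rightarrow> (nat \<Rightarrow> real) \<Rightarrow> real" where
  "enorm_d d x = sqrt (\<Sum>i<d. (x i)\<^sup>2)"

definition prob_ball :: "nat \<Rightarrow> real \<Rightarrow> (nat \<Rightarrow> real) measure set" where
  "prob_ball d r = {M. prob_space M \<and> sets M = sets (borel_d d) \<and>
       measure M {x \<in> space M. enorm_d d x \<le> r} = 1}"

definition gauss_dens :: "nat \<Rightarrow> real \<Rightarrow> (nat \<Rightarrow> real) \<Rightarrow> real" where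
  "gauss_dens d \<sigma> x = (2 * pi * \<sigma>\<^sup>2) powr (- real d / 2) * exp (- (enorm_d d x)\<^sup>2 / (2 * \<sigma>\<^sup>2))"

definition conv_dens :: "nat \<Rightarrow> real \<Rightarrow> (nat \<Rightarrow> real) measure \<Rightarrow> (nat \<Rightarrow> real) \<Rightarrow> real" where
  "conv_dens d \<sigma> M y = (\<integral>x. gauss_dens d \<sigma> (\<lambda>i. y i - x i) \<partial>M)"

text \<open>Renyi divergence of two measures given by (everywhere positive) Lebesgue densities p, q.\<close>
definition renyi_dens :: "real \<Rightarrow> nat \<Rightarrow> ((nat \<Rightarrow> real) \<Rightarrow> real) \<Rightarrow> ((nat \<Rightarrow> real) \<Rightarrow> real) \<Rightarrow> real" where
  "renyi_dens \<alpha> d p q = ln (\<integral>y. p y powr \<alpha> * q y powr (1 - \<alpha>) \<partial>leb d) / (\<alpha> - 1)"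

definition renyi_smooth :: "real \<Rightarrow> nat \<Rightarrow> real \<Rightarrow> (nat \<Rightarrow> real) measure \<Rightarrow> (nat \<Rightarrow> real) measure \<Rightarrow> real" where
  "renyi_smooth \<alpha> d \<sigma> M N = renyi_dens \<alpha> d (conv_dens d \<sigma> M) (conv_dens d \<sigma> N)"

definition emp :: "nat \<Rightarrow> (nat \<Rightarrow> 'a) \<Rightarrow> 'a measure" where
  "emp n X = measure_pmf (map_pmf X (pmf_of_set {..<n}))"

definition sample_space :: "nat \<Rightarrow> 'a measure \<Rightarrow> 'a measure \<Rightarrow> ((nat \<Rightarrow> 'a) \<times> (nat \<Rightarrow> 'a)) measure" where
  "sample_space n M N = PiM {..<n} (\<lambda>_. M) \<Otimes>\<^sub>M PiM {..<n} (\<lambda>_. N)"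

definition xi_tilde :: "real \<Rightarrow> nat \<Rightarrow> real \<Rightarrow> real" where
  "xi_tilde r d \<sigma> = (3 * exp 1 * real d) ^ (3 * (d + 2)) * (r + 1) powr (real d / 2 + 1) * \<sigma> powr (- real d / 2)"

definition b_const :: "real \<Rightarrow> real \<Rightarrow> real" where
  "b_const r \<sigma> = (r\<^sup>2 + 4 * r) / \<sigma>\<^sup>2"

definition lambda_const :: "real \<Rightarrow> nat \<Rightarrow> real \<Rightarrow> real \<Rightarrow> real" where
  "lambda_const \<alpha> d r \<sigma> = (\<alpha> / \<bar>\<alpha> - 1\<bar> + 1) *
     exp ((\<alpha> + 1) * b_const r \<sigma> * (1 + r + sqrt (real d) * \<sigma> / 2 + real d * (\<alpha> + 1) * b_const r \<sigma> * \<sigma>\<^sup>2))"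

end

theory Submission
  imports Defs
begin

text \<open>
All densities in play are mixtures of the Gaussians centred in the ball, so any two of them differ by
a factor of at most \<open>R y = exp ((4 r |y| + r\<^sup>2) / (2 \<sigma>\<^sup>2))\<close>. With \<open>m = max \<alpha> 1\<close> and
\<open>B\<close> a bound for the integral of \<open>R powr m\<close> against each mixture, the Hellinger integrals are at least
\<open>1 / B\<close>, and their logarithms are Lipschitz with constant \<open>B m\<close> in the \<open>L\<^sup>1\<close>
distance of the densities weighted by \<open>R powr m\<close>. That weighted distance between an empirical mixture
and its mean has expectation \<open>O(n\<^bsup>-1/2\<^esup>)\<close> by a pointwise variance bound, and changes by at
most \<open>2 B / n\<close> when one sample point is replaced, so McDiarmid's inequality gives its tail. The
exponent of \<open>\<lambda>\<close> dominates \<open>B\<^sup>2\<close>.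
\<close>

section \<open>Moments and concentration on product spaces\<close>

text \<open>The difficulty is that \<open>C\<close> must not depend on the dimension d, while the
  exponent of \<open>lambda_const\<close> tends to 0 with r. With y = (\<alpha> + 1) r sqrt d /
  \<sigma>, that exponent offers a term 16 y^2, so exponential moments of the Gaussian norm may cost
  exp (O(y) + O(y^2)) but no factor exp (c d) and no term linear in d r / \<sigma>. Bounding the
  Euclidean norm by the sum of the coordinates would already lose too much; widening the Gaussian by
  a relative amount of order r / (\<sigma> sqrt d) does not. What is left over linear in y is
  absorbed by completing a square, which produces the universal factor \<open>exp 5\<close>. Two
  constants measure the weighted densities. Replacing one sample point involves two single kernels,
  so \<open>B\<close> suffices there. The variance bound at a fixed y needs an envelope over all
  centres in the ball, and its weighted mass \<open>T\<close> is the one that accompanies 1 / sqrt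
  n. The tail obtained is the subgaussian exp (- n z^2) for each sample, which is at most the tail
  with the minimum; the factor 2 counts the two samples.\<close>

lemma (in prob_space) Hoeffding_oscillation:
  fixes f :: "'a \<Rightarrow> real"
  assumes [measurable]: "f \<in> borel_measurable M" and "l > 0" "c \<ge> 0"
    and osc: "\<And>x y. x \<in> space M \<Longrightarrow> y \<in> space M \<Longrightarrow> \<bar>f x - f y\<bar> \<le> c"
  shows "(\<integral>\<^sup>+x. ennreal (exp (l * f x)) \<partial>M) \<le> ennreal (exp (l * expectation f + l\<^sup>2 * c\<^sup>2 / 8))"
proof -
  \<comment> \<open>Oscillation at most c confines the range to an interval of length c starting at
    the infimum, which is the form that Hoeffding's lemma requires.\<close>
  define a where "a = (INF x\<in>space M. f x)"
  obtain x0 where x0: "x0 \<in> space M"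
    using not_empty by blast
  have bdd: "bdd_below (f ` space M)"
    using osc[OF x0] by (intro bdd_belowI2[of _ "f x0 - c"]) (force simp: abs_le_iff)
  have lower: "a \<le> f x" if "x \<in> space M" for x
    unfolding a_def using bdd that by (rule cINF_lower)
  have upper: "f x \<le> a + c" if "x \<in> space M" for x
  proof -
    have "f x - c \<le> a"
      unfolding a_def using osc[OF that] not_empty
      by (intro cINF_greatest) (force simp: abs_le_iff)+
    then show ?thesis by simp
  qed
  interpret interval_bounded_random_variable M f a "a + c"
    using lower upper by unfold_locales auto
  have "(\<integral>\<^sup>+x. ennreal (exp (l * f x)) \<partial>M)
      = (\<integral>\<^sup>+x. ennreal (exp (l * expectation f)) * ennreal (exp (l * (f x - expectation f))) \<partial>M)"
    by (intro nn_integral_cong) (simp flip: ennreal_mult exp_add add: algebra_simps)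
  also have "\<dots> = ennreal (exp (l * expectation f)) * (\<integral>\<^sup>+x. ennreal (exp (l * (f x - expectation f))) \<partial>M)"
    by (intro nn_integral_cmult) auto
  also have "\<dots> \<le> ennreal (exp (l * expectation f)) * ennreal (exp (l\<^sup>2 * c\<^sup>2 / 8))"
    using Hoeffdings_lemma_nn_integral[OF \<open>l > 0\<close>] by (intro mult_left_mono) auto
  also have "\<dots> = ennreal (exp (l * expectation f + l\<^sup>2 * c\<^sup>2 / 8))"
    by (simp flip: ennreal_mult exp_add)
  finally show ?thesis .
qed

text \<open>Induction on the coordinates takes the place of a martingale. Integrating out coordinate
  i costs the factor exp (l^2 c_i^2 / 8) by Hoeffding's lemma on each slice, and the slice mean
  \<open>g\<close> that remains in the exponent inherits both the bound \<open>K\<close> and the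
  bounded differences in the other coordinates. The bound \<open>K\<close> secures all
  integrability.\<close>

lemma McDiarmid_exp_moment:
  fixes f :: "('i \<Rightarrow> 'a) \<Rightarrow> real"
  assumes prob: "\<And>i. prob_space (M i)"
  assumes "finite I" "f \<in> borel_measurable (PiM I M)" "l > 0" "\<And>i. i \<in> I \<Longrightarrow> c i \<ge> 0"
    and "\<And>x. x \<in> space (PiM I M) \<Longrightarrow> \<bar>f x\<bar> \<le> K"
    and "\<And>x i y. x \<in> space (PiM I M) \<Longrightarrow> i \<in> I \<Longrightarrow> y \<in> space (M i) \<Longrightarrow> \<bar>f x - f (x(i := y))\<bar> \<le> c i"
  shows "(\<integral>\<^sup>+x. ennreal (exp (l * f x)) \<partial>PiM I M)
    \<le> ennreal (exp (l * (\<integral>x. f x \<partial>PiM I M) + l\<^sup>2 * (\<Sum>i\<in>I. (c i)\<^sup>2) / 8))"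
  using assms(2-)
proof (induction I arbitrary: f rule: finite_induct)
  case empty
  then show ?case
    by (simp add: PiM_empty nn_integral_count_space_finite lebesgue_integral_count_space_finite)
next
  case (insert i I)
  note [measurable] = insert.prems(1)
  interpret product_sigma_finite M
    using prob by (simp add: product_sigma_finite_def prob_space_imp_sigma_finite)
  interpret P: prob_space "PiM I M"
    by (intro prob_space_PiM prob)
  interpret Q: prob_space "PiM (insert i I) M"
    by (intro prob_space_PiM prob)
  interpret R: prob_space "M i"
    by (rule prob)
  define g where "g x = (\<integral>y. f (x(i := y)) \<partial>M i)" for x
  have upd: "x(i := y) \<in> space (PiM (insert i I) M)" if "x \<in> space (PiM I M)" "y \<in> space (M i)" for x y
    using that by (auto simp: space_PiM PiE_iff extensional_def)
  have [measurable]: "(\<lambda>(x, y). f (x(i := y))) \<in> borel_measurable (PiM I M \<Otimes>\<^sub>M M i)"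
    using measurable_compose[OF measurable_add_dim[of i I M] insert.prems(1)]
    by (simp add: case_prod_unfold)
  have g_meas [measurable]: "g \<in> borel_measurable (PiM I M)"
    unfolding g_def by measurable
  have slice_meas [measurable]: "(\<lambda>y. f (x(i := y))) \<in> borel_measurable (M i)" if "x \<in> space (PiM I M)" for x
    using that measurable_compose_Pair1[of x "PiM I M" "\<lambda>(x, y). f (x(i := y))" "M i" borel] by simp
  have slice_int: "integrable (M i) (\<lambda>y. f (x(i := y)))" if "x \<in> space (PiM I M)" for x
    using that insert.prems(4) upd by (intro R.integrable_const_bound[of _ K]) auto
  have g_bound: "\<bar>g x\<bar> \<le> K" if "x \<in> space (PiM I M)" for x
  proof -
    have "\<bar>g x\<bar> \<le> (\<integral>y. \<bar>f (x(i := y))\<bar> \<partial>M i)"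
      unfolding g_def by (rule integral_abs_bound)
    also have "\<dots> \<le> K"
      using that insert.prems(4) upd slice_int by (intro R.integral_le_const) auto
    finally show ?thesis .
  qed
  have g_diff: "\<bar>g x - g (x(j := z))\<bar> \<le> c j"
    if x: "x \<in> space (PiM I M)" and j: "j \<in> I" and z: "z \<in> space (M j)" for x j z
  proof -
    have "i \<noteq> j" using j insert.hyps by auto
    have xz: "x(j := z) \<in> space (PiM I M)"
      using x z j by (auto simp: space_PiM PiE_iff extensional_def)
    \<comment> \<open>Updates at the distinct coordinates i and j commute, so the difference bound
      of \<open>f\<close> in coordinate j holds under the integral over y.\<close>
    have "\<bar>g x - g (x(j := z))\<bar> = \<bar>\<integral>y. f (x(i := y)) - f (x(j := z, i := y)) \<partial>M i\<bar>"
      unfolding g_def using slice_int[OF x] slice_int[OF xz] by simp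
    also have "\<dots> \<le> (\<integral>y. \<bar>f (x(i := y)) - f (x(j := z, i := y))\<bar> \<partial>M i)"
      by (rule integral_abs_bound)
    also have "\<dots> \<le> c j"
      using slice_int[OF x] slice_int[OF xz] insert.prems(5)[OF upd[OF x], of _ j z] j z
      by (intro R.integral_le_const) (auto simp: fun_upd_twist[OF \<open>i \<noteq> j\<close>] simp del: fun_upd_apply)
    finally show ?thesis .
  qed
  have ci: "c i \<ge> 0" using insert.prems(3) by auto
  have osc: "\<bar>f (x(i := y)) - f (x(i := z))\<bar> \<le> c i"
    if "x \<in> space (PiM I M)" "y \<in> space (M i)" "z \<in> space (M i)" for x y z
    using insert.prems(5)[OF upd[OF that(1,2)], of i z] that
    by (simp del: fun_upd_apply)
  have "(\<integral>\<^sup>+x. ennreal (exp (l * f x)) \<partial>PiM (insert i I) M)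
      = (\<integral>\<^sup>+x. (\<integral>\<^sup>+y. ennreal (exp (l * f (x(i := y)))) \<partial>M i) \<partial>PiM I M)"
    using insert.hyps by (intro product_nn_integral_insert) auto
  also have "\<dots> \<le> (\<integral>\<^sup>+x. ennreal (exp (l * g x + l\<^sup>2 * (c i)\<^sup>2 / 8)) \<partial>PiM I M)"
    using R.Hoeffding_oscillation[OF slice_meas \<open>l > 0\<close> ci osc]
    by (intro nn_integral_mono) (auto simp: g_def)
  also have "\<dots> = (\<integral>\<^sup>+x. ennreal (exp (l\<^sup>2 * (c i)\<^sup>2 / 8)) * ennreal (exp (l * g x)) \<partial>PiM I M)"
    by (simp flip: ennreal_mult exp_add add: add.commute)
  also have "\<dots> = ennreal (exp (l\<^sup>2 * (c i)\<^sup>2 / 8)) * (\<integral>\<^sup>+x. ennreal (exp (l * g x)) \<partial>PiM I M)"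
    by (intro nn_integral_cmult) measurable
  also have "\<dots> \<le> ennreal (exp (l\<^sup>2 * (c i)\<^sup>2 / 8)) *
      ennreal (exp (l * (\<integral>x. g x \<partial>PiM I M) + l\<^sup>2 * (\<Sum>i\<in>I. (c i)\<^sup>2) / 8))"
    using insert.prems(3) g_bound g_diff g_meas
    by (intro mult_left_mono insert.IH[OF _ \<open>l > 0\<close>]) (auto simp del: fun_upd_apply)
  also have "(\<integral>x. g x \<partial>PiM I M) = (\<integral>x. f x \<partial>PiM (insert i I) M)"
    unfolding g_def using insert.hyps insert.prems(4)
    by (intro product_integral_insert[symmetric] Q.integrable_const_bound[of _ K]) auto
  also have "ennreal (exp (l\<^sup>2 * (c i)\<^sup>2 / 8)) *
        ennreal (exp (l * (\<integral>x. f x \<partial>PiM (insert i I) M) + l\<^sup>2 * (\<Sum>i\<in>I. (c i)\<^sup>2) / 8))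
      = ennreal (exp (l * (\<integral>x. f x \<partial>PiM (insert i I) M) + l\<^sup>2 * (\<Sum>i\<in>insert i I. (c i)\<^sup>2) / 8))"
    using insert.hyps by (simp flip: ennreal_mult exp_add add: algebra_simps add_divide_distrib)
  finally show ?case .
qed

text \<open>Chernoff's inequality applied to the moment bound. The case t = 0 is split off because
  Chernoff needs l > 0; there the right-hand side is 1.\<close>

theorem McDiarmid:
  fixes f :: "('i \<Rightarrow> 'a) \<Rightarrow> real"
  assumes prob: "\<And>i. prob_space (M i)" and fin: "finite I" and [measurable]: "f \<in> borel_measurable (PiM I M)"
    and c: "\<And>i. i \<in> I \<Longrightarrow> c i \<ge> 0" and pos: "(\<Sum>i\<in>I. (c i)\<^sup>2) > 0"
    and bdd: "\<And>x. x \<in> space (PiM I M) \<Longrightarrow> \<bar>f x\<bar> \<le> K"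
    and diff: "\<And>x i y. x \<in> space (PiM I M) \<Longrightarrow> i \<in> I \<Longrightarrow> y \<in> space (M i) \<Longrightarrow> \<bar>f x - f (x(i := y))\<bar> \<le> c i"
    and t: "t \<ge> 0"
  shows "measure (PiM I M) {x \<in> space (PiM I M). f x \<ge> (\<integral>x. f x \<partial>PiM I M) + t}
    \<le> exp (- 2 * t\<^sup>2 / (\<Sum>i\<in>I. (c i)\<^sup>2))"
proof (cases "t = 0")
  case True
  interpret P: prob_space "PiM I M"
    by (intro prob_space_PiM prob)
  show ?thesis using True by simp
next
  case False
  with t have "t > 0" by simp
  interpret P: prob_space "PiM I M"
    by (intro prob_space_PiM prob)
  define S where "S = (\<Sum>i\<in>I. (c i)\<^sup>2)"
  \<comment> \<open>The minimiser of - l t + l^2 S / 8 in l; the minimum is - 2 t^2 / S.\<close>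
  define l where "l = 4 * t / S"
  define E where "E = (\<integral>x. f x \<partial>PiM I M)"
  have "S > 0" using pos by (simp add: S_def)
  have "l > 0" using \<open>t > 0\<close> \<open>S > 0\<close> by (simp add: l_def)
  have "emeasure (PiM I M) {x \<in> space (PiM I M). f x \<ge> E + t}
      \<le> ennreal (exp (- l * (E + t))) * (\<integral>\<^sup>+x. ennreal (exp (l * f x)) \<partial>PiM I M)"
    using Chernoff_ineq_nn_integral_ge[OF \<open>l > 0\<close>, of "space (PiM I M)" "PiM I M" f "E + t"]
    by (simp add: nn_integral_set_ennreal)
  also have "ennreal (exp (- l * (E + t))) * (\<integral>\<^sup>+x. ennreal (exp (l * f x)) \<partial>PiM I M)
      \<le> ennreal (exp (- l * (E + t))) * ennreal (exp (l * E + l\<^sup>2 * S / 8))"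
    unfolding E_def S_def
    by (intro mult_left_mono McDiarmid_exp_moment[OF prob fin _ \<open>l > 0\<close> c bdd diff]) (auto simp del: fun_upd_apply)
  also have "\<dots> = ennreal (exp (- l * (E + t) + (l * E + l\<^sup>2 * S / 8)))"
    by (simp flip: ennreal_mult exp_add)
  also have "- l * (E + t) + (l * E + l\<^sup>2 * S / 8) = - 2 * t\<^sup>2 / S"
    using \<open>S > 0\<close> by (simp add: l_def power2_eq_square field_simps)
  finally show ?thesis
    unfolding E_def S_def by (simp add: P.emeasure_eq_measure)
qed

section \<open>Mean absolute deviation of empirical averages\<close>

text \<open>Integrating the new coordinate first kills the cross term, since \<open>h\<close> has
  mean 0; each coordinate thus adds exactly one second moment of \<open>h\<close>.\<close>

lemma second_moment_sum_PiM:
  fixes h :: "'a \<Rightarrow> real"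
  assumes prob: "prob_space M" and "finite I" and [measurable]: "h \<in> borel_measurable M"
    and bdd: "\<And>x. x \<in> space M \<Longrightarrow> \<bar>h x\<bar> \<le> K" and mean: "(\<integral>x. h x \<partial>M) = 0"
  shows "(\<integral>X. (\<Sum>i\<in>I. h (X i))\<^sup>2 \<partial>PiM I (\<lambda>_. M)) = real (card I) * (\<integral>x. (h x)\<^sup>2 \<partial>M)"
  using \<open>finite I\<close>
proof (induction I rule: finite_induct)
  case empty
  then show ?case by simp
next
  case (insert i I)
  interpret product_sigma_finite "\<lambda>_. M"
    using prob by (simp add: product_sigma_finite_def prob_space_imp_sigma_finite)
  interpret R: prob_space M by (rule prob)
  interpret P: prob_space "PiM I (\<lambda>_. M)"
    by (intro prob_space_PiM prob)
  interpret Q: prob_space "PiM (insert i I) (\<lambda>_. M)"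
    by (intro prob_space_PiM prob)
  have sum_bdd: "\<bar>\<Sum>j\<in>J. h (X j)\<bar> \<le> real (card J) * K" if "X \<in> space (PiM J (\<lambda>_. M))" for X J
    using that bdd by (intro order_trans[OF sum_abs] sum_bounded_above) (auto simp: space_PiM PiE_iff)
  have sq_bdd: "(\<Sum>j\<in>J. h (X j))\<^sup>2 \<le> (real (card J) * K)\<^sup>2" if "X \<in> space (PiM J (\<lambda>_. M))" for X J
    using power_mono[OF sum_bdd[OF that], of 2] by simp
  have h_int [simp]: "integrable M h"
    using bdd by (intro R.integrable_const_bound[of _ K]) auto
  have h2_int [simp]: "integrable M (\<lambda>x. (h x)\<^sup>2)"
    using power_mono[OF bdd, of _ 2] by (intro R.integrable_const_bound[of _ "K\<^sup>2"]) auto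
  have S2_int [simp]: "integrable (PiM I (\<lambda>_. M)) (\<lambda>X. (\<Sum>j\<in>I. h (X j))\<^sup>2)"
    using sq_bdd[of _ I] by (intro P.integrable_const_bound[of _ "(real (card I) * K)\<^sup>2"]) auto
  have "(\<integral>X. (\<Sum>j\<in>insert i I. h (X j))\<^sup>2 \<partial>PiM (insert i I) (\<lambda>_. M))
      = (\<integral>X. (\<integral>y. (\<Sum>j\<in>insert i I. h ((X(i := y)) j))\<^sup>2 \<partial>M) \<partial>PiM I (\<lambda>_. M))"
    using insert.hyps sq_bdd[of _ "insert i I"]
    by (intro product_integral_insert Q.integrable_const_bound[of _ "(real (card (insert i I)) * K)\<^sup>2"]) auto
  also have "\<dots> = (\<integral>X. (\<integral>y. (\<Sum>j\<in>I. h (X j))\<^sup>2 + (2 * (\<Sum>j\<in>I. h (X j)) * h y + (h y)\<^sup>2) \<partial>M) \<partial>PiM I (\<lambda>_. M))"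
  proof (intro Bochner_Integration.integral_cong refl)
    fix X y
    have "(\<Sum>j\<in>I. h ((X(i := y)) j)) = (\<Sum>j\<in>I. h (X j))"
      using insert.hyps by (intro sum.cong) auto
    then show "(\<Sum>j\<in>insert i I. h ((X(i := y)) j))\<^sup>2
        = (\<Sum>j\<in>I. h (X j))\<^sup>2 + (2 * (\<Sum>j\<in>I. h (X j)) * h y + (h y)\<^sup>2)"
      using insert.hyps by (simp add: power2_sum del: fun_upd_apply) (simp add: algebra_simps)
  qed
  also have "\<dots> = (\<integral>X. (\<Sum>j\<in>I. h (X j))\<^sup>2 + (\<integral>x. (h x)\<^sup>2 \<partial>M) \<partial>PiM I (\<lambda>_. M))"
    by (simp add: mean R.prob_space)
  also have "\<dots> = real (card (insert i I)) * (\<integral>x. (h x)\<^sup>2 \<partial>M)"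
    using insert.hyps by (simp add: insert.IH P.prob_space algebra_simps)
  finally show ?case .
qed

text \<open>The square of the mean deviation is at most its second moment, which is the variance of
  \<open>g\<close> divided by n. As both \<open>g\<close> and its mean lie in the interval from 0 to
  K, the centred function is bounded by K, and so is its standard deviation.\<close>

lemma expectation_abs_empirical_mean_le:
  fixes g :: "'a \<Rightarrow> real"
  assumes prob: "prob_space M" and n: "n \<ge> 1" and [measurable]: "g \<in> borel_measurable M"
    and bdd: "\<And>x. x \<in> space M \<Longrightarrow> 0 \<le> g x \<and> g x \<le> K"
  shows "(\<integral>X. \<bar>(\<Sum>i<n. g (X i)) / real n - (\<integral>x. g x \<partial>M)\<bar> \<partial>PiM {..<n} (\<lambda>_. M)) \<le> K / sqrt (real n)"
proof -
  interpret R: prob_space M by (rule prob)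
  interpret P: prob_space "PiM {..<n} (\<lambda>_. M)"
    by (intro prob_space_PiM prob)
  obtain x0 where "x0 \<in> space M" using R.not_empty by blast
  with bdd[of x0] have "K \<ge> 0" by simp
  define m where "m = (\<integral>x. g x \<partial>M)"
  define h where "h x = g x - m" for x
  have g_int: "integrable M g"
    using bdd by (intro R.integrable_const_bound[of _ K]) auto
  have "0 \<le> m"
    unfolding m_def using bdd by (intro integral_nonneg_AE) auto
  have "m \<le> K"
    unfolding m_def using bdd g_int by (intro R.integral_le_const) auto
  have h_bdd: "\<bar>h x\<bar> \<le> K" if "x \<in> space M" for x
    using bdd[OF that] \<open>0 \<le> m\<close> \<open>m \<le> K\<close> unfolding h_def by (simp add: abs_le_iff)
  have h_meas [measurable]: "h \<in> borel_measurable M"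
    unfolding h_def by measurable
  have h_mean: "(\<integral>x. h x \<partial>M) = 0"
    unfolding h_def using g_int by (simp add: m_def R.prob_space)
  have h2: "(\<integral>x. (h x)\<^sup>2 \<partial>M) \<le> K\<^sup>2"
    using power_mono[OF h_bdd, of _ 2]
    by (intro R.integral_le_const R.integrable_const_bound[of _ "K\<^sup>2"]) auto
  define Z where "Z X = \<bar>(\<Sum>i<n. g (X i)) / real n - m\<bar>" for X :: "nat \<Rightarrow> 'a"
  have Z_eq: "Z X = \<bar>\<Sum>i<n. h (X i)\<bar> / real n" for X
  proof -
    have "(\<Sum>i<n. h (X i)) = (\<Sum>i<n. g (X i)) - real n * m"
      by (simp add: h_def sum_subtractf)
    then have "\<bar>\<Sum>i<n. h (X i)\<bar> / real n = \<bar>((\<Sum>i<n. g (X i)) - real n * m) / real n\<bar>"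
      by (simp add: abs_divide)
    also have "\<dots> = Z X"
      using n by (simp add: Z_def diff_divide_distrib)
    finally show ?thesis by simp
  qed
  have Z_bdd: "\<bar>Z X\<bar> \<le> K" if "X \<in> space (PiM {..<n} (\<lambda>_. M))" for X
  proof -
    have "\<bar>\<Sum>i<n. h (X i)\<bar> \<le> real (card {..<n}) * K"
      using that h_bdd by (intro order_trans[OF sum_abs] sum_bounded_above) (auto simp: space_PiM PiE_iff)
    then show ?thesis
      using n by (simp add: Z_eq field_simps)
  qed
  have [measurable]: "Z \<in> borel_measurable (PiM {..<n} (\<lambda>_. M))"
    unfolding Z_def by measurable
  have Z_int: "integrable (PiM {..<n} (\<lambda>_. M)) Z"
    using Z_bdd by (intro P.integrable_const_bound[of _ K]) auto
  have Z2_int: "integrable (PiM {..<n} (\<lambda>_. M)) (\<lambda>X. (Z X)\<^sup>2)"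
    using power_mono[OF Z_bdd, of _ 2] by (intro P.integrable_const_bound[of _ "K\<^sup>2"]) auto
  \<comment> \<open>This is the nonnegativity of the variance of \<open>Z\<close>.\<close>
  have "(P.expectation Z)\<^sup>2 \<le> P.expectation (\<lambda>X. (Z X)\<^sup>2)"
    using P.variance_positive[of Z] P.variance_eq[OF Z_int Z2_int] by simp
  also have "\<dots> = P.expectation (\<lambda>X. (\<Sum>i<n. h (X i))\<^sup>2) / (real n)\<^sup>2"
    by (simp add: Z_eq power_divide)
  also have "\<dots> = (\<integral>x. (h x)\<^sup>2 \<partial>M) / real n"
    using second_moment_sum_PiM[OF prob finite_lessThan h_meas h_bdd h_mean, of n] n
    by (simp add: power2_eq_square)
  also have "\<dots> \<le> (K / sqrt (real n))\<^sup>2"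
    using h2 by (simp add: power_divide divide_right_mono)
  finally show ?thesis
    using \<open>K \<ge> 0\<close> n power2_le_imp_le[of "P.expectation Z" "K / sqrt (real n)"]
    by (simp add: Z_def[abs_def] m_def)
qed

section \<open>Weighted deviations of empirical kernel averages\<close>

text \<open>An abstract form of smoothing: \<open>G x\<close> is the density contributed by the
  point x, \<open>H\<close> an envelope over all x, \<open>W\<close> the weight. \<open>B\<close>
  bounds the weighted mass of a single kernel and governs bounded differences; the integral of
  \<open>H * W\<close> governs the expectation. The kernel bounds hold at every point of the space
  because the difference condition in McDiarmid's inequality is pointwise.\<close>

locale weighted_kernel = M: prob_space M + L: sigma_finite_measure L
  for M :: "'a measure" and L :: "'b measure" +
  fixes G :: "'a \<Rightarrow> 'b \<Rightarrow> real" and H W :: "'b \<Rightarrow> real" and B :: real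
  assumes G_meas [measurable]: "(\<lambda>(x, y). G x y) \<in> borel_measurable (M \<Otimes>\<^sub>M L)"
    and H_meas [measurable]: "H \<in> borel_measurable L"
    and W_meas [measurable]: "W \<in> borel_measurable L"
    and G_bounds: "\<And>x y. x \<in> space M \<Longrightarrow> y \<in> space L \<Longrightarrow> 0 \<le> G x y \<and> G x y \<le> H y"
    and W_nonneg: "\<And>y. y \<in> space L \<Longrightarrow> 0 \<le> W y"
    and HW_int: "integrable L (\<lambda>y. H y * W y)"
    and GW_le: "\<And>x. x \<in> space M \<Longrightarrow> (\<integral>y. G x y * W y \<partial>L) \<le> B"
    and B_pos: "B > 0"
begin

definition mean_G :: "'b \<Rightarrow> real" where
  "mean_G y = (\<integral>x. G x y \<partial>M)"

definition deviation :: "nat \<Rightarrow> (nat \<Rightarrow> 'a) \<Rightarrow> real" where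
  "deviation n X = (\<integral>y. \<bar>(\<Sum>i<n. G (X i) y) / real n - mean_G y\<bar> * W y \<partial>L)"

lemma G_meas_left [measurable]: "y \<in> space L \<Longrightarrow> (\<lambda>x. G x y) \<in> borel_measurable M"
  using measurable_compose[OF measurable_Pair2' G_meas, of y] by simp

lemma mean_G_meas [measurable]: "mean_G \<in> borel_measurable L"
  unfolding mean_G_def by measurable

lemma H_nonneg: "y \<in> space L \<Longrightarrow> 0 \<le> H y"
  using M.not_empty G_bounds by force

lemma G_int: "y \<in> space L \<Longrightarrow> integrable M (\<lambda>x. G x y)"
  using G_bounds by (intro M.integrable_const_bound[of _ "H y"]) auto

lemma mean_G_bounds: "y \<in> space L \<Longrightarrow> 0 \<le> mean_G y \<and> mean_G y \<le> H y"
  using G_bounds G_int unfolding mean_G_def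
  by (intro conjI integral_nonneg_AE M.integral_le_const) auto

lemma integrable_dominated:
  assumes "f \<in> borel_measurable L" "\<And>y. y \<in> space L \<Longrightarrow> \<bar>f y\<bar> \<le> H y"
  shows "integrable L (\<lambda>y. f y * W y)"
  using assms H_nonneg W_nonneg
  by (intro Bochner_Integration.integrable_bound[OF HW_int])
     (auto simp: abs_mult intro!: mult_right_mono order_trans[OF _ abs_ge_self])

lemma GW_int: "x \<in> space M \<Longrightarrow> integrable L (\<lambda>y. G x y * W y)"
  using G_bounds by (intro integrable_dominated) auto

lemma mean_GW_int: "integrable L (\<lambda>y. mean_G y * W y)"
  using mean_G_bounds by (intro integrable_dominated) auto

text \<open>Tonelli. The factor \<open>V\<close> is left free: \<open>V = W\<close> gives the
  weighted mass of the mixture, and \<open>V = 1\<close> its total mass.\<close>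

lemma nn_integral_mean_G:
  assumes [measurable]: "V \<in> borel_measurable L" and V: "\<And>y. y \<in> space L \<Longrightarrow> 0 \<le> V y"
  shows "(\<integral>\<^sup>+y. ennreal (mean_G y * V y) \<partial>L) = (\<integral>\<^sup>+x. (\<integral>\<^sup>+y. ennreal (G x y * V y) \<partial>L) \<partial>M)"
proof -
  interpret pair_sigma_finite M L ..
  have "(\<integral>\<^sup>+y. ennreal (mean_G y * V y) \<partial>L) = (\<integral>\<^sup>+y. (\<integral>\<^sup>+x. ennreal (G x y * V y) \<partial>M) \<partial>L)"
  proof (intro nn_integral_cong)
    fix y assume y: "y \<in> space L"
    have "(\<integral>\<^sup>+x. ennreal (G x y * V y) \<partial>M) = ennreal (\<integral>x. G x y * V y \<partial>M)"
      using y G_bounds V G_int by (intro nn_integral_eq_integral) auto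
    then show "ennreal (mean_G y * V y) = (\<integral>\<^sup>+x. ennreal (G x y * V y) \<partial>M)"
      by (simp add: mean_G_def)
  qed
  also have "\<dots> = (\<integral>\<^sup>+x. (\<integral>\<^sup>+y. ennreal (G x y * V y) \<partial>L) \<partial>M)"
    by (intro Fubini') measurable
  finally show ?thesis .
qed

lemma mean_GW_le: "(\<integral>y. mean_G y * W y \<partial>L) \<le> B"
proof -
  have "(\<integral>\<^sup>+y. ennreal (mean_G y * W y) \<partial>L) = (\<integral>\<^sup>+x. (\<integral>\<^sup>+y. ennreal (G x y * W y) \<partial>L) \<partial>M)"
    using W_nonneg by (intro nn_integral_mean_G) auto
  also have "\<dots> \<le> (\<integral>\<^sup>+x. ennreal B \<partial>M)"
  proof (intro nn_integral_mono)
    fix x assume x: "x \<in> space M"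
    have "(\<integral>\<^sup>+y. ennreal (G x y * W y) \<partial>L) = ennreal (\<integral>y. G x y * W y \<partial>L)"
      using x G_bounds W_nonneg GW_int by (intro nn_integral_eq_integral) auto
    then show "(\<integral>\<^sup>+y. ennreal (G x y * W y) \<partial>L) \<le> ennreal B"
      using GW_le[OF x] by (simp add: ennreal_leI)
  qed
  also have "\<dots> = ennreal B"
    by (simp add: M.emeasure_space_1)
  finally have "(\<integral>\<^sup>+y. ennreal (mean_G y * W y) \<partial>L) \<le> ennreal B" .
  moreover have "(\<integral>\<^sup>+y. ennreal (mean_G y * W y) \<partial>L) = ennreal (\<integral>y. mean_G y * W y \<partial>L)"
    using mean_GW_int mean_G_bounds W_nonneg by (intro nn_integral_eq_integral) auto
  ultimately show ?thesis
    using B_pos by simp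
qed

lemma empirical_bounds:
  assumes "n \<ge> 1" "X \<in> space (PiM {..<n} (\<lambda>_. M))" "y \<in> space L"
  shows "0 \<le> (\<Sum>i<n. G (X i) y) / real n \<and> (\<Sum>i<n. G (X i) y) / real n \<le> H y"
proof -
  have X: "X i \<in> space M" if "i < n" for i
    using assms(2) that by (auto simp: space_PiM PiE_iff)
  have "(\<Sum>i<n. G (X i) y) \<le> real (card {..<n}) * H y"
    using X G_bounds assms by (intro sum_bounded_above) auto
  moreover have "0 \<le> (\<Sum>i<n. G (X i) y)"
    using X G_bounds assms by (intro sum_nonneg) auto
  ultimately show ?thesis
    using assms by (simp add: field_simps)
qed

lemma deviation_integrand_bound:
  assumes "n \<ge> 1" "X \<in> space (PiM {..<n} (\<lambda>_. M))" "y \<in> space L"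
  shows "\<bar>(\<Sum>i<n. G (X i) y) / real n - mean_G y\<bar> \<le> H y"
  using empirical_bounds[OF assms] mean_G_bounds[OF assms(3)] by (simp add: abs_le_iff)

lemma pair_meas [measurable]:
  "(\<lambda>(X, y). \<bar>(\<Sum>i<n. G (X i) y) / real n - mean_G y\<bar>) \<in> borel_measurable (PiM {..<n} (\<lambda>_. M) \<Otimes>\<^sub>M L)"
proof -
  have [measurable]: "(\<lambda>(X, y). G (X i) y) \<in> borel_measurable (PiM {..<n} (\<lambda>_. M) \<Otimes>\<^sub>M L)" if "i < n" for i
  proof -
    have "(\<lambda>p. (fst p i, snd p)) \<in> PiM {..<n} (\<lambda>_. M) \<Otimes>\<^sub>M L \<rightarrow>\<^sub>M M \<Otimes>\<^sub>M L"
      using that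
      by (intro measurable_Pair measurable_compose[OF measurable_fst measurable_component_singleton]
          measurable_snd) auto
    from measurable_compose[OF this G_meas] show ?thesis
      by (simp add: case_prod_unfold)
  qed
  show ?thesis
    by measurable
qed

lemma deviation_meas [measurable]: "deviation n \<in> borel_measurable (PiM {..<n} (\<lambda>_. M))"
  unfolding deviation_def using pair_meas[of n] by measurable

lemma slice_meas:
  assumes "X \<in> space (PiM {..<n} (\<lambda>_. M))"
  shows "(\<lambda>y. \<bar>(\<Sum>i<n. G (X i) y) / real n - mean_G y\<bar>) \<in> borel_measurable L"
  using measurable_compose_Pair1[OF assms pair_meas] by simp

lemma slice_int:
  assumes "n \<ge> 1" "X \<in> space (PiM {..<n} (\<lambda>_. M))"
  shows "integrable L (\<lambda>y. \<bar>(\<Sum>i<n. G (X i) y) / real n - mean_G y\<bar> * W y)"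
  using slice_meas[OF assms(2)] deviation_integrand_bound[OF assms]
  by (intro integrable_dominated) auto

text \<open>Only the i-th summand changes, so the empirical averages differ at y by (G (X i) y - G x
  y) / n. Bounding this by the sum of the two kernels, rather than by the envelope, gives
  \<open>B\<close> instead of the integral of \<open>H * W\<close>.\<close>

lemma deviation_diff:
  assumes n: "n \<ge> 1" and X: "X \<in> space (PiM {..<n} (\<lambda>_. M))" and i: "i < n" and x: "x \<in> space M"
  shows "\<bar>deviation n X - deviation n (X(i := x))\<bar> \<le> 2 * B / real n"
proof -
  let ?X = "X(i := x)"
  have X': "?X \<in> space (PiM {..<n} (\<lambda>_. M))"
    using X i x by (auto simp: space_PiM PiE_iff extensional_def)
  have Xi: "X i \<in> space M"
    using X i by (auto simp: space_PiM PiE_iff)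
  let ?e = "\<lambda>X y. (\<Sum>i<n. G (X i) y) / real n"
  have split: "(\<Sum>j<n. G (Z j) y) = G (Z i) y + (\<Sum>j\<in>{..<n} - {i}. G (Z j) y)" for Z y
    using i by (intro sum.remove) auto
  have eq: "?e X y - ?e ?X y = (G (X i) y - G x y) / real n" for y
    unfolding split[of X] split[of ?X] by (simp add: add_divide_distrib diff_divide_distrib)
  have "\<bar>deviation n X - deviation n ?X\<bar>
      = \<bar>\<integral>y. \<bar>?e X y - mean_G y\<bar> * W y - \<bar>?e ?X y - mean_G y\<bar> * W y \<partial>L\<bar>"
    unfolding deviation_def using slice_int[OF n X] slice_int[OF n X'] by simp
  also have "\<dots> \<le> (\<integral>y. \<bar>\<bar>?e X y - mean_G y\<bar> * W y - \<bar>?e ?X y - mean_G y\<bar> * W y\<bar> \<partial>L)"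
    by (rule integral_abs_bound)
  also have "\<dots> \<le> (\<integral>y. (G (X i) y * W y + G x y * W y) / real n \<partial>L)"
  proof (intro integral_mono)
    fix y assume y: "y \<in> space L"
    have "\<bar>\<bar>?e X y - mean_G y\<bar> * W y - \<bar>?e ?X y - mean_G y\<bar> * W y\<bar>
        = \<bar>\<bar>?e X y - mean_G y\<bar> - \<bar>?e ?X y - mean_G y\<bar>\<bar> * W y"
      using W_nonneg[OF y] by (simp add: abs_mult flip: left_diff_distrib)
    also have "\<dots> \<le> \<bar>?e X y - ?e ?X y\<bar> * W y"
      using W_nonneg[OF y] by (intro mult_right_mono) linarith+
    also have "\<dots> = \<bar>G (X i) y - G x y\<bar> / real n * W y"
      by (simp only: eq abs_divide)
    also have "\<dots> \<le> (G (X i) y + G x y) / real n * W y"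
      using W_nonneg[OF y] G_bounds[OF Xi y] G_bounds[OF x y]
      by (intro mult_right_mono divide_right_mono) (auto simp: abs_le_iff)
    finally show "\<bar>\<bar>?e X y - mean_G y\<bar> * W y - \<bar>?e ?X y - mean_G y\<bar> * W y\<bar>
        \<le> (G (X i) y * W y + G x y * W y) / real n"
      by (simp add: algebra_simps)
  qed (use slice_int[OF n X] slice_int[OF n X'] GW_int[OF Xi] GW_int[OF x] in auto)
  also have "\<dots> = ((\<integral>y. G (X i) y * W y \<partial>L) + (\<integral>y. G x y * W y \<partial>L)) / real n"
    using GW_int[OF Xi] GW_int[OF x] by simp
  also have "\<dots> \<le> 2 * B / real n"
    using GW_le[OF Xi] GW_le[OF x] by (intro divide_right_mono) auto
  finally show ?thesis .
qed

lemma deviation_bound: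
  assumes n: "n \<ge> 1" and X: "X \<in> space (PiM {..<n} (\<lambda>_. M))"
  shows "\<bar>deviation n X\<bar> \<le> (\<integral>y. H y * W y \<partial>L)"
proof -
  have "0 \<le> deviation n X"
    unfolding deviation_def using W_nonneg by (intro integral_nonneg_AE) auto
  moreover have "deviation n X \<le> (\<integral>y. H y * W y \<partial>L)"
    unfolding deviation_def using slice_int[OF n X] HW_int deviation_integrand_bound[OF n X] W_nonneg
    by (intro integral_mono mult_right_mono) auto
  ultimately show ?thesis by simp
qed

text \<open>Tonelli moves the expectation inside the integral over y. For fixed y the quantity is
  the deviation of an average of n independent variables with values between 0 and
  \<open>H y\<close>, so its mean is at most H y / sqrt n. No uniformity over a class of functions
  is required.\<close>

lemma expectation_deviation_le:
  assumes n: "n \<ge> 1"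
  shows "(\<integral>X. deviation n X \<partial>PiM {..<n} (\<lambda>_. M)) \<le> (\<integral>y. H y * W y \<partial>L) / sqrt (real n)"
proof -
  let ?P = "PiM {..<n} (\<lambda>_. M)"
  let ?d = "\<lambda>X y. \<bar>(\<Sum>i<n. G (X i) y) / real n - mean_G y\<bar>"
  interpret P: prob_space ?P
    by (intro prob_space_PiM M.prob_space_axioms)
  interpret pair_sigma_finite ?P L ..
  note pm = pair_meas[of n, measurable]
  have dev_nonneg: "0 \<le> deviation n X" for X
    unfolding deviation_def using W_nonneg by (intro integral_nonneg_AE) auto
  have dev_int: "integrable ?P (deviation n)"
    using deviation_bound[OF n] by (intro P.integrable_const_bound) auto
  have HW_nonneg: "0 \<le> (\<integral>y. H y * W y \<partial>L)"
    using H_nonneg W_nonneg by (intro integral_nonneg_AE) auto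
  have "ennreal (\<integral>X. deviation n X \<partial>?P) = (\<integral>\<^sup>+X. ennreal (deviation n X) \<partial>?P)"
    using dev_nonneg dev_int by (intro nn_integral_eq_integral[symmetric]) auto
  also have "\<dots> = (\<integral>\<^sup>+X. (\<integral>\<^sup>+y. ennreal (?d X y * W y) \<partial>L) \<partial>?P)"
    unfolding deviation_def using slice_int[OF n] W_nonneg
    by (intro nn_integral_cong nn_integral_eq_integral[symmetric]) auto
  also have "\<dots> = (\<integral>\<^sup>+y. (\<integral>\<^sup>+X. ennreal (?d X y * W y) \<partial>?P) \<partial>L)"
    by (intro Fubini'[symmetric]) measurable
  also have "\<dots> \<le> (\<integral>\<^sup>+y. ennreal (H y * W y / sqrt (real n)) \<partial>L)"
  proof (intro nn_integral_mono)
    fix y assume y: "y \<in> space L"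
    have [measurable]: "(\<lambda>X. ?d X y) \<in> borel_measurable ?P"
      using y by measurable
    have int: "integrable ?P (\<lambda>X. ?d X y)"
      using deviation_integrand_bound[OF n _ y] by (intro P.integrable_const_bound[of _ "H y"]) auto
    have "(\<integral>\<^sup>+X. ennreal (?d X y * W y) \<partial>?P) = ennreal ((\<integral>X. ?d X y \<partial>?P) * W y)"
      unfolding integral_mult_left_zero[symmetric] using int W_nonneg[OF y] by (intro nn_integral_eq_integral) auto
    also have "\<dots> \<le> ennreal (H y / sqrt (real n) * W y)"
      using expectation_abs_empirical_mean_le[OF M.prob_space_axioms n G_meas_left[OF y] G_bounds[OF _ y]]
      unfolding mean_G_def by (intro ennreal_leI mult_right_mono W_nonneg[OF y])
    finally show "(\<integral>\<^sup>+X. ennreal (?d X y * W y) \<partial>?P) \<le> ennreal (H y * W y / sqrt (real n))"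
      by simp
  qed
  also have "\<dots> = ennreal (\<integral>y. H y * W y / sqrt (real n) \<partial>L)"
    using HW_int H_nonneg W_nonneg by (intro nn_integral_eq_integral) auto
  finally show ?thesis
    using HW_nonneg by simp
qed

text \<open>The n squared differences (2 B / n)^2 add up to 4 B^2 / n, and McDiarmid's exponent
  becomes n t^2 / (2 B^2). Choosing t = sqrt 2 * B * z later turns it into n z^2.\<close>

theorem deviation_tail:
  assumes n: "n \<ge> 1" and t: "t \<ge> 0"
  shows "measure (PiM {..<n} (\<lambda>_. M))
      {X \<in> space (PiM {..<n} (\<lambda>_. M)). deviation n X \<ge> (\<integral>y. H y * W y \<partial>L) / sqrt (real n) + t}
    \<le> exp (- real n * t\<^sup>2 / (2 * B\<^sup>2))"
proof -
  let ?P = "PiM {..<n} (\<lambda>_. M)"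
  interpret P: prob_space ?P
    by (intro prob_space_PiM M.prob_space_axioms)
  have sum: "(\<Sum>i<n. (2 * B / real n)\<^sup>2) = 4 * B\<^sup>2 / real n"
    using n by (simp add: power2_eq_square)
  have "measure ?P {X \<in> space ?P. deviation n X \<ge> (\<integral>y. H y * W y \<partial>L) / sqrt (real n) + t}
      \<le> measure ?P {X \<in> space ?P. deviation n X \<ge> P.expectation (deviation n) + t}"
    using expectation_deviation_le[OF n] by (intro P.finite_measure_mono) auto
  also have "\<dots> \<le> exp (- 2 * t\<^sup>2 / (\<Sum>i<n. (2 * B / real n)\<^sup>2))"
    using B_pos n t deviation_bound[OF n] deviation_diff[OF n]
    by (intro McDiarmid M.prob_space_axioms) (auto simp: sum simp del: fun_upd_apply)
  also have "\<dots> = exp (- real n * t\<^sup>2 / (2 * B\<^sup>2))"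
    unfolding sum by simp
  finally show ?thesis .
qed

end

section \<open>Gaussian densities\<close>

lemma enorm_d_L2_set: "enorm_d d x = L2_set x {..<d}"
  by (simp add: enorm_d_def L2_set_def)

lemma enorm_d_nonneg [simp]: "0 \<le> enorm_d d x"
  by (simp add: enorm_d_L2_set)

lemma enorm_d_diff_le: "enorm_d d (\<lambda>i. y i - x i) \<le> enorm_d d y + enorm_d d x"
  using L2_set_triangle_ineq[of y "\<lambda>i. - x i" "{..<d}"] by (simp add: enorm_d_L2_set L2_set_def)

lemma enorm_d_le_diff: "enorm_d d y \<le> enorm_d d (\<lambda>i. y i - x i) + enorm_d d x"
  using L2_set_triangle_ineq[of "\<lambda>i. y i - x i" x "{..<d}"] by (simp add: enorm_d_L2_set)

lemma sigma_finite_leb: "sigma_finite_measure (leb d)"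
proof -
  interpret product_sigma_finite "\<lambda>_::nat. lborel :: real measure" ..
  show ?thesis
    unfolding leb_def by (rule sigma_finite) simp
qed

lemma enorm_d_meas_leb [measurable]: "enorm_d d \<in> borel_measurable (leb d)"
  unfolding enorm_d_def[abs_def] leb_def by measurable

lemma enorm_d_meas_borel_d [measurable]: "enorm_d d \<in> borel_measurable (borel_d d)"
  unfolding enorm_d_def[abs_def] borel_d_def by measurable

lemma gauss_dens_pos [simp]: "0 < \<sigma> \<Longrightarrow> 0 < gauss_dens d \<sigma> x"
  by (simp add: gauss_dens_def)

lemma gauss_dens_meas:
  assumes "sets M = sets (borel_d d)"
  shows "(\<lambda>(x, y). gauss_dens d \<sigma> (\<lambda>i. y i - x i)) \<in> borel_measurable (M \<Otimes>\<^sub>M leb d)"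
proof -
  have "(\<lambda>(x, y). gauss_dens d \<sigma> (\<lambda>i. y i - x i)) \<in> borel_measurable (borel_d d \<Otimes>\<^sub>M leb d)"
    unfolding gauss_dens_def enorm_d_def leb_def borel_d_def by measurable
  moreover have "sets (M \<Otimes>\<^sub>M leb d) = sets (borel_d d \<Otimes>\<^sub>M leb d)"
    using assms by (intro sets_pair_measure_cong) auto
  ultimately show ?thesis
    by (simp cong: measurable_cong_sets)
qed

lemma gauss_dens_shift_meas_leb [measurable]: "(\<lambda>y. gauss_dens d \<sigma> (\<lambda>i. y i - x i)) \<in> borel_measurable (leb d)"
  unfolding gauss_dens_def enorm_d_def leb_def by measurable

lemma gauss_dens_shift_meas:
  assumes "sets M = sets (borel_d d)"
  shows "(\<lambda>x. gauss_dens d \<sigma> (\<lambda>i. y i - x i)) \<in> borel_measurable M"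
proof -
  have "(\<lambda>x. gauss_dens d \<sigma> (\<lambda>i. y i - x i)) \<in> borel_measurable (borel_d d)"
    unfolding gauss_dens_def enorm_d_def borel_d_def by measurable
  then show ?thesis
    using assms by (simp cong: measurable_cong_sets)
qed

text \<open>The factorisation reduces the total mass in dimension d to that of the one-dimensional
  normal density.\<close>

lemma gauss_dens_prod:
  assumes "\<sigma> > 0"
  shows "gauss_dens d \<sigma> (\<lambda>i. y i - x i) = (\<Prod>i<d. normal_density (x i) \<sigma> (y i))"
proof -
  have "(\<Prod>i<d. normal_density (x i) \<sigma> (y i))
      = (1 / sqrt (2 * pi * \<sigma>\<^sup>2)) ^ d * exp (- (\<Sum>i<d. (y i - x i)\<^sup>2) / (2 * \<sigma>\<^sup>2))"
    by (simp add: normal_density_def prod.distrib prod_dividef exp_sum sum_negf sum_divide_distrib power_one_over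
        flip: exp_sum)
  also have "(1 / sqrt (2 * pi * \<sigma>\<^sup>2)) ^ d = (2 * pi * \<sigma>\<^sup>2) powr (- real d / 2)"
  proof -
    have pos: "0 < 2 * pi * \<sigma>\<^sup>2" using assms by simp
    have "1 / sqrt (2 * pi * \<sigma>\<^sup>2) = (2 * pi * \<sigma>\<^sup>2) powr (- 1 / 2)"
      using pos by (simp add: powr_minus_divide flip: powr_half_sqrt)
    then have "(1 / sqrt (2 * pi * \<sigma>\<^sup>2)) ^ d = ((2 * pi * \<sigma>\<^sup>2) powr (- 1 / 2)) powr real d"
      using pos by (subst powr_realpow) auto
    then show ?thesis
      by (simp add: powr_powr)
  qed
  finally show ?thesis
    by (simp add: gauss_dens_def enorm_d_def sum_nonneg)
qed

section \<open>Exponential moments of the norm under a Gaussian\<close>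

lemma nn_integral_gauss_dens:
  assumes "\<sigma> > 0"
  shows "(\<integral>\<^sup>+y. ennreal (gauss_dens d \<sigma> (\<lambda>i. y i - x i)) \<partial>leb d) = 1"
proof -
  interpret product_sigma_finite "\<lambda>_::nat. lborel :: real measure" ..
  have "(\<integral>\<^sup>+y. ennreal (gauss_dens d \<sigma> (\<lambda>i. y i - x i)) \<partial>leb d)
      = (\<integral>\<^sup>+y. (\<Prod>i<d. ennreal (normal_density (x i) \<sigma> (y i))) \<partial>leb d)"
    using assms by (simp add: gauss_dens_prod prod_ennreal)
  also have "\<dots> = (\<Prod>i<d. \<integral>\<^sup>+y. ennreal (normal_density (x i) \<sigma> y) \<partial>lborel)"
    unfolding leb_def by (intro product_nn_integral_prod) auto
  also have "\<dots> = 1"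
    using assms by (simp add: nn_integral_eq_integral)
  finally show ?thesis .
qed

text \<open>By AM-GM the factor \<open>exp (\<kappa> * norm u)\<close> is absorbed by widening the Gaussian to variance
  \<open>\<sigma>\<^sup>2 / (1 - v)\<close>; the choice of \<open>v\<close> keeps the price free of any factor exponential in \<open>d\<close>
  when \<open>s\<close> is small.\<close>
lemma gauss_dens_exp_norm_le:
  assumes \<sigma>: "\<sigma> > 0" and d: "d \<ge> 1" and "\<kappa> \<ge> 0"
  defines "s \<equiv> \<kappa> * \<sigma>"
  defines "v \<equiv> s / (sqrt (real d) + 2 * s)"
  shows "gauss_dens d \<sigma> u * exp (\<kappa> * enorm_d d u)
    \<le> exp (3 / 2 * (s * sqrt (real d)) + s\<^sup>2) * gauss_dens d (\<sigma> / sqrt (1 - v)) u"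
proof -
  define e where "e = enorm_d d u"
  have "s \<ge> 0" using assms by (simp add: s_def)
  have sd: "sqrt (real d) \<ge> 1" using d by simp
  then have den: "sqrt (real d) + 2 * s > 0" using \<open>s \<ge> 0\<close> by linarith
  have v0: "v \<ge> 0" using \<open>s \<ge> 0\<close> den by (simp add: v_def)
  have v2: "v \<le> 1 / 2" using sd den by (simp add: v_def field_simps)
  have vs: "v * (sqrt (real d) + 2 * s) = s" using den by (simp add: v_def)
  \<comment> \<open>Expand 0 \<le> v (w - a)^2 / 2 with w = e / \<sigma> and a = sqrt d + 2 s. The
    definition of \<open>v\<close> says v a = s, so the cross term is exactly s w.\<close>
  have norm_le: "\<kappa> * e \<le> v * e\<^sup>2 / (2 * \<sigma>\<^sup>2) + s * (sqrt (real d) + 2 * s) / 2"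
  proof -
    define w where "w = e / \<sigma>"
    define a where "a = sqrt (real d) + 2 * s"
    have a: "a > 0" using den by (simp add: a_def)
    have "0 \<le> v * (w - a)\<^sup>2 / 2" using v0 by simp
    also have "\<dots> = v * w\<^sup>2 / 2 - (v * a) * w + (v * a) * a / 2"
      by (simp add: power2_eq_square field_simps)
    also have "\<dots> = v * w\<^sup>2 / 2 - s * w + s * a / 2"
      using vs by (simp add: a_def)
    finally have "s * w \<le> v * w\<^sup>2 / 2 + s * a / 2" by simp
    then show ?thesis
      using \<sigma> by (simp add: w_def a_def s_def power_divide)
  qed
  have ln_ge: "ln (1 - v) \<ge> - 2 * v"
  proof -
    have "v * v \<le> v * (1 / 2)" using v0 v2 by (intro mult_left_mono) auto
    then show ?thesis
      using ln_one_minus_pos_lower_bound[OF v0 v2] by (simp add: power2_eq_square)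
  qed
  \<comment> \<open>As v is at most s / sqrt d, the change of the normalising constant, (1 - v) to
    the power - d / 2, costs at most exp (d v) \<le> exp (s sqrt d).\<close>
  have dv: "real d * v \<le> s * sqrt (real d)"
  proof -
    have "v * sqrt (real d) + 2 * (v * s) = s" "0 \<le> v * s"
      using vs v0 \<open>s \<ge> 0\<close> by (simp_all add: distrib_left)
    then have "sqrt (real d) * v \<le> s"
      by (simp add: mult.commute[of "sqrt (real d)"])
    from mult_left_mono[OF this, of "sqrt (real d)"] show ?thesis
      by (simp add: mult.commute[of s] flip: mult.assoc)
  qed
  have "(\<sigma> / sqrt (1 - v))\<^sup>2 = \<sigma>\<^sup>2 / (1 - v)"
    using v2 by (simp add: power_divide)
  then have expo: "- e\<^sup>2 / (2 * (\<sigma> / sqrt (1 - v))\<^sup>2) = - ((1 - v) * e\<^sup>2 / (2 * \<sigma>\<^sup>2))"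
    by simp
  have "(2 * pi * (\<sigma> / sqrt (1 - v))\<^sup>2) powr (- real d / 2)
      = (2 * pi * \<sigma>\<^sup>2) powr (- real d / 2) * exp (real d / 2 * ln (1 - v))"
  proof -
    have "2 * pi * (\<sigma> / sqrt (1 - v))\<^sup>2 = 2 * pi * \<sigma>\<^sup>2 / (1 - v)"
      using v2 by (simp add: power_divide)
    also have "\<dots> powr (- real d / 2) = (2 * pi * \<sigma>\<^sup>2) powr (- real d / 2) / (1 - v) powr (- real d / 2)"
      using v2 by (simp add: powr_divide)
    also have "\<dots> = (2 * pi * \<sigma>\<^sup>2) powr (- real d / 2) * exp (real d / 2 * ln (1 - v))"
    proof -
      have "(1 - v) powr (- real d / 2) = exp (- (real d / 2 * ln (1 - v)))"
        using v2 unfolding powr_def by simp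
      then show ?thesis
        by (simp only: exp_minus divide_inverse inverse_inverse_eq)
    qed
    finally show ?thesis .
  qed
  then have rhs: "gauss_dens d (\<sigma> / sqrt (1 - v)) u
      = (2 * pi * \<sigma>\<^sup>2) powr (- real d / 2) * exp (real d / 2 * ln (1 - v) - (1 - v) * e\<^sup>2 / (2 * \<sigma>\<^sup>2))"
    unfolding gauss_dens_def e_def[symmetric] expo by (simp add: mult.assoc flip: exp_add)
  \<comment> \<open>The coefficient 3 / 2 is 1 / 2 from the inequality for the norm plus 1 from the
    normalisation; the s^2 comes from the norm alone.\<close>
  have "- e\<^sup>2 / (2 * \<sigma>\<^sup>2) + \<kappa> * e
      \<le> 3 / 2 * (s * sqrt (real d)) + s\<^sup>2 + (real d / 2 * ln (1 - v) - (1 - v) * e\<^sup>2 / (2 * \<sigma>\<^sup>2))"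
  proof -
    have "real d / 2 * ln (1 - v) \<ge> real d / 2 * (- 2 * v)"
      using ln_ge by (intro mult_left_mono) auto
    then have "real d / 2 * ln (1 - v) \<ge> - (s * sqrt (real d))"
      using dv by simp
    moreover have "s * (sqrt (real d) + 2 * s) / 2 = s * sqrt (real d) / 2 + s\<^sup>2"
      by (simp add: power2_eq_square field_simps)
    moreover have "(1 - v) * e\<^sup>2 / (2 * \<sigma>\<^sup>2) = e\<^sup>2 / (2 * \<sigma>\<^sup>2) - v * e\<^sup>2 / (2 * \<sigma>\<^sup>2)"
      by (simp add: algebra_simps diff_divide_distrib)
    ultimately show ?thesis
      using norm_le by (simp add: add_divide_distrib)
  qed
  then have "exp (- e\<^sup>2 / (2 * \<sigma>\<^sup>2)) * exp (\<kappa> * e)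
      \<le> exp (3 / 2 * (s * sqrt (real d)) + s\<^sup>2) * exp (real d / 2 * ln (1 - v) - (1 - v) * e\<^sup>2 / (2 * \<sigma>\<^sup>2))"
    by (simp flip: exp_add)
  then have "(2 * pi * \<sigma>\<^sup>2) powr (- real d / 2) * (exp (- e\<^sup>2 / (2 * \<sigma>\<^sup>2)) * exp (\<kappa> * e))
      \<le> (2 * pi * \<sigma>\<^sup>2) powr (- real d / 2) *
        (exp (3 / 2 * (s * sqrt (real d)) + s\<^sup>2) * exp (real d / 2 * ln (1 - v) - (1 - v) * e\<^sup>2 / (2 * \<sigma>\<^sup>2)))"
    by (intro mult_left_mono) auto
  then show ?thesis
    unfolding rhs by (simp add: gauss_dens_def e_def mult_ac)
qed

text \<open>The triangle inequality moves the norm to y - x at the cost exp (\<kappa> r). The factor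
  left is then dominated by a constant times the widened Gaussian, which has mass one.\<close>

lemma nn_integral_gauss_exp_norm_le:
  assumes \<sigma>: "\<sigma> > 0" and d: "d \<ge> 1" and \<kappa>: "\<kappa> \<ge> 0" and x: "enorm_d d x \<le> r"
  shows "(\<integral>\<^sup>+y. ennreal (gauss_dens d \<sigma> (\<lambda>i. y i - x i) * exp (\<kappa> * enorm_d d y)) \<partial>leb d)
    \<le> ennreal (exp (\<kappa> * r + 3 / 2 * (\<kappa> * \<sigma> * sqrt (real d)) + (\<kappa> * \<sigma>)\<^sup>2))"
proof -
  define s where "s = \<kappa> * \<sigma>"
  define v where "v = s / (sqrt (real d) + 2 * s)"
  define K where "K = \<kappa> * r + (3 / 2 * (s * sqrt (real d)) + s\<^sup>2)"
  have "s \<ge> 0" using \<sigma> \<kappa> by (simp add: s_def)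
  have "sqrt (real d) \<ge> 1" using d by simp
  then have "s < sqrt (real d) + 2 * s" "0 < sqrt (real d) + 2 * s" using \<open>s \<ge> 0\<close> by linarith+
  then have "v < 1" by (simp add: v_def)
  then have \<sigma>': "\<sigma> / sqrt (1 - v) > 0" using \<sigma> by simp
  have "(\<integral>\<^sup>+y. ennreal (gauss_dens d \<sigma> (\<lambda>i. y i - x i) * exp (\<kappa> * enorm_d d y)) \<partial>leb d)
      \<le> (\<integral>\<^sup>+y. ennreal (exp K) * ennreal (gauss_dens d (\<sigma> / sqrt (1 - v)) (\<lambda>i. y i - x i)) \<partial>leb d)"
  proof (intro nn_integral_mono)
    fix y :: "nat \<Rightarrow> real"
    let ?u = "\<lambda>i. y i - x i"
    have "enorm_d d y \<le> r + enorm_d d ?u"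
      using enorm_d_le_diff[of d y x] x by simp
    then have "exp (\<kappa> * enorm_d d y) \<le> exp (\<kappa> * r) * exp (\<kappa> * enorm_d d ?u)"
      using \<kappa> by (simp flip: exp_add distrib_left add: mult_left_mono)
    then have "gauss_dens d \<sigma> ?u * exp (\<kappa> * enorm_d d y)
        \<le> exp (\<kappa> * r) * (gauss_dens d \<sigma> ?u * exp (\<kappa> * enorm_d d ?u))"
      using gauss_dens_pos[OF \<sigma>, of d ?u] by (simp add: mult.left_commute)
    also have "\<dots> \<le> exp (\<kappa> * r) * (exp (3 / 2 * (s * sqrt (real d)) + s\<^sup>2) * gauss_dens d (\<sigma> / sqrt (1 - v)) ?u)"
      using gauss_dens_exp_norm_le[OF \<sigma> d \<kappa>, of ?u] by (simp add: s_def v_def)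
    also have "\<dots> = exp K * gauss_dens d (\<sigma> / sqrt (1 - v)) ?u"
      by (simp add: K_def exp_add)
    finally show "ennreal (gauss_dens d \<sigma> ?u * exp (\<kappa> * enorm_d d y))
        \<le> ennreal (exp K) * ennreal (gauss_dens d (\<sigma> / sqrt (1 - v)) ?u)"
      by (simp add: ennreal_leI flip: ennreal_mult')
  qed
  also have "\<dots> = ennreal (exp K)"
    using nn_integral_gauss_dens[OF \<sigma>', of d x] by (simp add: nn_integral_cmult)
  finally show ?thesis
    by (simp add: K_def s_def add.assoc)
qed

section \<open>Gaussian bounds uniform over centres in the ball\<close>

definition gauss_lower :: "nat \<Rightarrow> real \<Rightarrow> real \<Rightarrow> (nat \<Rightarrow> real) \<Rightarrow> real" where
  "gauss_lower d \<sigma> r y = gauss_dens d \<sigma> y * exp (- (2 * r * enorm_d d y + r\<^sup>2) / (2 * \<sigma>\<^sup>2))"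

definition gauss_upper :: "nat \<Rightarrow> real \<Rightarrow> real \<Rightarrow> (nat \<Rightarrow> real) \<Rightarrow> real" where
  "gauss_upper d \<sigma> r y = gauss_dens d \<sigma> y * exp (r * enorm_d d y / \<sigma>\<^sup>2)"

definition gauss_ratio :: "nat \<Rightarrow> real \<Rightarrow> real \<Rightarrow> (nat \<Rightarrow> real) \<Rightarrow> real" where
  "gauss_ratio d \<sigma> r y = exp ((4 * r * enorm_d d y + r\<^sup>2) / (2 * \<sigma>\<^sup>2))"

lemma gauss_upper_eq: "\<sigma> > 0 \<Longrightarrow> gauss_upper d \<sigma> r y = gauss_lower d \<sigma> r y * gauss_ratio d \<sigma> r y"
  by (simp add: gauss_upper_def gauss_lower_def gauss_ratio_def field_simps flip: exp_add)

text \<open>The squared distance from y to a centre of norm at most r lies between |y|^2 - 2 r |y|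
  and (|y| + r)^2. The lower end omits the r^2 of (|y| - r)^2 so that it stays valid for |y| < r,
  where the distance may vanish.\<close>

lemma gauss_dens_bounds:
  assumes \<sigma>: "\<sigma> > 0" and x: "enorm_d d x \<le> r"
  shows "gauss_lower d \<sigma> r y \<le> gauss_dens d \<sigma> (\<lambda>i. y i - x i)"
    and "gauss_dens d \<sigma> (\<lambda>i. y i - x i) \<le> gauss_upper d \<sigma> r y"
proof -
  let ?e = "enorm_d d y" and ?f = "enorm_d d (\<lambda>i. y i - x i)"
  have "?f \<le> ?e + r" using enorm_d_diff_le[of d y x] x by simp
  then have "?f\<^sup>2 \<le> (?e + r)\<^sup>2" by (intro power_mono) auto
  then have "?f\<^sup>2 \<le> ?e\<^sup>2 + (2 * r * ?e + r\<^sup>2)" by (simp add: power2_sum mult_ac)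
  from divide_right_mono[OF this, of "2 * \<sigma>\<^sup>2"] show "gauss_lower d \<sigma> r y \<le> gauss_dens d \<sigma> (\<lambda>i. y i - x i)"
    using \<sigma> unfolding gauss_lower_def gauss_dens_def mult.assoc exp_add[symmetric]
    by (intro mult_left_mono) (auto simp: add_divide_distrib diff_divide_distrib)
  have "?e\<^sup>2 - 2 * r * ?e \<le> ?f\<^sup>2"
  proof (cases "?e \<ge> r")
    case True
    have "?e - r \<le> ?f" using enorm_d_le_diff[of d y x] x by simp
    then have "(?e - r)\<^sup>2 \<le> ?f\<^sup>2" using True by (intro power_mono) auto
    moreover have "(?e - r)\<^sup>2 = ?e\<^sup>2 - 2 * r * ?e + r\<^sup>2" by (simp add: power2_diff mult_ac)
    ultimately show ?thesis using zero_le_power2[of r] by linarith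
  next
    case False
    then have "?e * ?e \<le> ?e * (2 * r)"
      using enorm_d_nonneg[of d y] by (intro mult_left_mono) linarith+
    then have "?e\<^sup>2 - 2 * r * ?e \<le> 0" by (simp add: power2_eq_square mult_ac)
    then show ?thesis using zero_le_power2[of ?f] by linarith
  qed
  from divide_right_mono[OF this, of "2 * \<sigma>\<^sup>2"] show "gauss_dens d \<sigma> (\<lambda>i. y i - x i) \<le> gauss_upper d \<sigma> r y"
    using \<sigma> unfolding gauss_upper_def gauss_dens_def mult.assoc exp_add[symmetric]
    by (intro mult_left_mono) (auto simp: add_divide_distrib diff_divide_distrib)
qed

section \<open>Hellinger integrals of comparable densities\<close>

text \<open>The mean value inequality for t-th powers. \<open>K\<close> is left abstract because the
  derivative will be bounded relative to another density, whatever the sign of t - 1.\<close>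

lemma powr_diff_le:
  fixes a b t l u K :: real
  assumes "0 < l" "a \<in> {l..u}" "b \<in> {l..u}" and K: "\<And>\<xi>. \<xi> \<in> {l..u} \<Longrightarrow> \<xi> powr (t - 1) \<le> K"
  shows "\<bar>a powr t - b powr t\<bar> \<le> \<bar>t\<bar> * K * \<bar>a - b\<bar>"
proof -
  have "norm (a powr t - b powr t) \<le> \<bar>t\<bar> * K * norm (a - b)"
  proof (rule field_differentiable_bound[where S = "{l..u}" and f' = "\<lambda>\<xi>. t * \<xi> powr (t - 1)"])
    show "((\<lambda>\<xi>. \<xi> powr t) has_field_derivative t * \<xi> powr (t - 1)) (at \<xi> within {l..u})"
      if "\<xi> \<in> {l..u}" for \<xi>
      using that \<open>0 < l\<close> by (intro has_real_derivative_powr[THEN has_field_derivative_at_within]) auto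
    show "norm (t * \<xi> powr (t - 1)) \<le> \<bar>t\<bar> * K" if "\<xi> \<in> {l..u}" for \<xi>
      using K[OF that] by (simp add: abs_mult mult_left_mono)
  qed (use assms in auto)
  then show ?thesis by simp
qed

text \<open>Logarithms of two points of \<open>{l..l * R}\<close> differ by at most ln R, so an
  exponent of modulus at most m, of either sign, gives at most R to the power m. The base
  \<open>l\<close> cancels.\<close>

lemma ratio_powr_le:
  fixes u v l R t m :: real
  assumes "0 < l" "1 \<le> R" "u \<in> {l..l * R}" "v \<in> {l..l * R}" "\<bar>t\<bar> \<le> m"
  shows "(u / v) powr t \<le> R powr m"
proof -
  have pos: "0 < u" "0 < v" using assms by auto
  have "\<bar>ln u - ln v\<bar> \<le> ln R"
  proof -
    have "ln l \<le> ln u" "ln l \<le> ln v" "ln u \<le> ln (l * R)" "ln v \<le> ln (l * R)"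
      using assms pos by (auto intro!: ln_mono)
    moreover have "ln (l * R) = ln l + ln R"
      using assms by (intro ln_mult_pos) auto
    ultimately show ?thesis by linarith
  qed
  have "t * (ln u - ln v) \<le> \<bar>t\<bar> * \<bar>ln u - ln v\<bar>"
    by (metis abs_ge_self abs_mult)
  also have "\<dots> \<le> m * ln R"
    using assms \<open>\<bar>ln u - ln v\<bar> \<le> ln R\<close> by (intro mult_mono) auto
  finally show ?thesis
    using assms pos by (simp add: powr_def ln_div)
qed

text \<open>The integrand is homogeneous of degree one in the pair of densities, so its partial
  derivatives depend on ratios only. Moving \<open>a\<close> with \<open>b\<close> fixed and then
  \<open>b\<close> with \<open>a'\<close> fixed, the mean value theorem produces (\<xi> / b) to the
  power \<alpha> - 1 and (\<xi> / a') to the power - \<alpha>. Both are at most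
  \<open>R powr m\<close>, hence no negative power of a small density survives.\<close>

lemma hellinger_integrand_diff_le:
  fixes a b a' b' l R \<alpha> m :: real
  assumes "0 < l" "1 \<le> R" "0 < \<alpha>" and m: "m = max \<alpha> 1"
    and a: "a \<in> {l..l * R}" and b: "b \<in> {l..l * R}" and a': "a' \<in> {l..l * R}" and b': "b' \<in> {l..l * R}"
  shows "\<bar>a powr \<alpha> * b powr (1 - \<alpha>) - a' powr \<alpha> * b' powr (1 - \<alpha>)\<bar>
    \<le> m * (\<bar>a - a'\<bar> * R powr m + \<bar>b - b'\<bar> * R powr m)"
proof -
  \<comment> \<open>The maximum of \<alpha> and 1 dominates both the exponents of the ratios and the
    prefactors |\<alpha>| and |1 - \<alpha>|.\<close>
  have m_ge: "\<bar>\<alpha>\<bar> \<le> m" "\<bar>\<alpha> - 1\<bar> \<le> m" "\<bar>1 - \<alpha>\<bar> \<le> m" "\<bar>- \<alpha>\<bar> \<le> m" "0 \<le> m"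
    using \<open>0 < \<alpha>\<close> m by auto
  have pos: "0 < b" "0 < a'" using assms by auto
  have "\<bar>a powr \<alpha> - a' powr \<alpha>\<bar> \<le> \<bar>\<alpha>\<bar> * (R powr m * b powr (\<alpha> - 1)) * \<bar>a - a'\<bar>"
  proof (rule powr_diff_le[OF \<open>0 < l\<close> a a'])
    fix \<xi> assume \<xi>: "\<xi> \<in> {l..l * R}"
    then have "0 < \<xi>" using \<open>0 < l\<close> by auto
    have "(\<xi> / b) powr (\<alpha> - 1) \<le> R powr m"
      using assms m_ge \<xi> by (intro ratio_powr_le) auto
    then show "\<xi> powr (\<alpha> - 1) \<le> R powr m * b powr (\<alpha> - 1)"
      using pos \<open>0 < \<xi>\<close> by (simp add: powr_divide divide_le_eq)
  qed
  then have "\<bar>a powr \<alpha> - a' powr \<alpha>\<bar> * b powr (1 - \<alpha>)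
      \<le> \<bar>\<alpha>\<bar> * (R powr m * b powr (\<alpha> - 1)) * \<bar>a - a'\<bar> * b powr (1 - \<alpha>)"
    by (intro mult_right_mono) auto
  also have "\<dots> = \<bar>\<alpha>\<bar> * (\<bar>a - a'\<bar> * R powr m) * (b powr (\<alpha> - 1) * b powr (1 - \<alpha>))"
    by (simp add: mult_ac)
  also have "b powr (\<alpha> - 1) * b powr (1 - \<alpha>) = 1"
    using pos by (simp flip: powr_add)
  also have "\<bar>\<alpha>\<bar> * (\<bar>a - a'\<bar> * R powr m) * 1 \<le> m * (\<bar>a - a'\<bar> * R powr m)"
    using m_ge by (auto intro!: mult_right_mono)
  finally have 1: "\<bar>a powr \<alpha> - a' powr \<alpha>\<bar> * b powr (1 - \<alpha>) \<le> m * (\<bar>a - a'\<bar> * R powr m)" .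
  have "\<bar>b powr (1 - \<alpha>) - b' powr (1 - \<alpha>)\<bar> \<le> \<bar>1 - \<alpha>\<bar> * (R powr m * a' powr (- \<alpha>)) * \<bar>b - b'\<bar>"
  proof (rule powr_diff_le[OF \<open>0 < l\<close> b b'])
    fix \<xi> assume \<xi>: "\<xi> \<in> {l..l * R}"
    then have "0 < \<xi>" using \<open>0 < l\<close> by auto
    have "(\<xi> / a') powr (- \<alpha>) \<le> R powr m"
      using assms m_ge \<xi> by (intro ratio_powr_le) auto
    then show "\<xi> powr (1 - \<alpha> - 1) \<le> R powr m * a' powr (- \<alpha>)"
      using pos \<open>0 < \<xi>\<close> by (simp add: powr_divide divide_le_eq)
  qed
  then have "a' powr \<alpha> * \<bar>b powr (1 - \<alpha>) - b' powr (1 - \<alpha>)\<bar>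
      \<le> a' powr \<alpha> * (\<bar>1 - \<alpha>\<bar> * (R powr m * a' powr (- \<alpha>)) * \<bar>b - b'\<bar>)"
    by (intro mult_left_mono) auto
  also have "\<dots> = \<bar>1 - \<alpha>\<bar> * (\<bar>b - b'\<bar> * R powr m) * (a' powr \<alpha> * a' powr (- \<alpha>))"
    by (simp add: mult_ac)
  also have "a' powr \<alpha> * a' powr (- \<alpha>) = 1"
    using pos by (simp flip: powr_add)
  also have "\<bar>1 - \<alpha>\<bar> * (\<bar>b - b'\<bar> * R powr m) * 1 \<le> m * (\<bar>b - b'\<bar> * R powr m)"
    using m_ge by (auto intro!: mult_right_mono)
  finally have 2: "a' powr \<alpha> * \<bar>b powr (1 - \<alpha>) - b' powr (1 - \<alpha>)\<bar> \<le> m * (\<bar>b - b'\<bar> * R powr m)" .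
  have "a powr \<alpha> * b powr (1 - \<alpha>) - a' powr \<alpha> * b' powr (1 - \<alpha>)
      = (a powr \<alpha> - a' powr \<alpha>) * b powr (1 - \<alpha>) + a' powr \<alpha> * (b powr (1 - \<alpha>) - b' powr (1 - \<alpha>))"
    by (simp add: algebra_simps)
  also have "\<bar>\<dots>\<bar> \<le> \<bar>a powr \<alpha> - a' powr \<alpha>\<bar> * b powr (1 - \<alpha>)
      + a' powr \<alpha> * \<bar>b powr (1 - \<alpha>) - b' powr (1 - \<alpha>)\<bar>"
    by (rule order_trans[OF abs_triangle_ineq]) (simp add: abs_mult)
  finally show ?thesis
    using 1 2 by (simp add: distrib_left)
qed

text \<open>The common lower bound \<open>lo\<close> makes the densities comparable but cancels from
  the quantitative estimates, which involve only \<open>R\<close>, \<open>B\<close> and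
  \<alpha>.\<close>

locale comparable_densities =
  fixes L :: "'b measure" and lo R :: "'b \<Rightarrow> real" and \<alpha> B :: real
  assumes lo_pos: "\<And>y. 0 < lo y" and R_ge: "\<And>y. 1 \<le> R y"
    and R_meas [measurable]: "R \<in> borel_measurable L"
    and \<alpha>: "0 < \<alpha>" and B: "0 < B"
begin

definition m :: real where "m = max \<alpha> 1"

text \<open>All conditions are stable under averaging, so checking them for one Gaussian settles
  them for every smoothed empirical measure.\<close>

definition dens :: "('b \<Rightarrow> real) \<Rightarrow> bool" where
  "dens p \<longleftrightarrow> p \<in> borel_measurable L \<and> (\<forall>y. p y \<in> {lo y..lo y * R y}) \<and>
    integrable L p \<and> (\<integral>y. p y \<partial>L) = 1 \<and>
    integrable L (\<lambda>y. p y * R y powr m) \<and> (\<integral>y. p y * R y powr m \<partial>L) \<le> B"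

definition hell :: "('b \<Rightarrow> real) \<Rightarrow> ('b \<Rightarrow> real) \<Rightarrow> real" where
  "hell p q = (\<integral>y. p y powr \<alpha> * q y powr (1 - \<alpha>) \<partial>L)"

lemma dens_pos: "dens p \<Longrightarrow> 0 < p y"
  using lo_pos[of y] unfolding dens_def by (meson atLeastAtMost_iff less_le_trans)

lemma hell_integrand:
  assumes p: "dens p" and q: "dens q"
  shows "p y powr \<alpha> * q y powr (1 - \<alpha>) = q y * (p y / q y) powr \<alpha>"
  using dens_pos[OF p, of y] dens_pos[OF q, of y] by (simp add: powr_divide powr_diff)

lemma ratio_le:
  assumes "dens p" "dens q"
  shows "(p y / q y) powr \<alpha> \<le> R y powr m"
  using assms lo_pos R_ge \<alpha> unfolding dens_def m_def by (intro ratio_powr_le[of "lo y"]) auto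

lemma hell_integrable:
  assumes p: "dens p" and q: "dens q"
  shows "integrable L (\<lambda>y. p y powr \<alpha> * q y powr (1 - \<alpha>))"
proof (rule Bochner_Integration.integrable_bound)
  show "integrable L (\<lambda>y. q y * R y powr m)" using q by (simp add: dens_def)
  have [measurable]: "p \<in> borel_measurable L" "q \<in> borel_measurable L"
    using p q by (simp_all add: dens_def)
  show "(\<lambda>y. p y powr \<alpha> * q y powr (1 - \<alpha>)) \<in> borel_measurable L" by measurable
  show "AE y in L. norm (p y powr \<alpha> * q y powr (1 - \<alpha>)) \<le> norm (q y * R y powr m)"
    using ratio_le[OF p q] dens_pos[OF q, THEN less_imp_le]
    unfolding hell_integrand[OF p q] by (auto simp: abs_mult intro!: mult_left_mono)
qed

text \<open>Integrate \<open>1 / w \<ge> 2 c - c\<^sup>2 w\<close> at \<open>c = 1 / B\<close>, where \<open>w = R powr m\<close>.\<close>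
lemma hell_ge:
  assumes p: "dens p" and q: "dens q"
  shows "1 / B \<le> hell p q"
proof -
  have int: "integrable L q" "(\<integral>y. q y \<partial>L) = 1" "integrable L (\<lambda>y. q y * R y powr m)"
      "(\<integral>y. q y * R y powr m \<partial>L) \<le> B"
    using q by (auto simp: dens_def)
  have "1 / B = 2 / B - (1 / B)\<^sup>2 * B"
    using B by (simp add: power2_eq_square)
  also have "\<dots> \<le> 2 / B * (\<integral>y. q y \<partial>L) - (1 / B)\<^sup>2 * (\<integral>y. q y * R y powr m \<partial>L)"
    using mult_left_mono[OF int(4), of "(1 / B)\<^sup>2"] by (simp add: int(2))
  also have "\<dots> = (\<integral>y. 2 / B * q y - (1 / B)\<^sup>2 * (q y * R y powr m) \<partial>L)"
    using int by simp
  also have "\<dots> \<le> hell p q"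
    unfolding hell_def
  proof (intro integral_mono hell_integrable[OF p q])
    show "integrable L (\<lambda>y. 2 / B * q y - (1 / B)\<^sup>2 * (q y * R y powr m))"
      using int by simp
    fix y
    define w where "w = R y powr m"
    have w: "0 < w" using R_ge[of y] by (simp add: w_def)
    \<comment> \<open>The upper bound on the ratio with the two densities exchanged; its reciprocal
      is the lower bound that is needed.\<close>
    have "(q y / p y) powr \<alpha> \<le> w"
      unfolding w_def by (rule ratio_le[OF q p])
    then have "1 / w \<le> (p y / q y) powr \<alpha>"
      using dens_pos[OF p, of y] dens_pos[OF q, of y] w
      by (simp add: powr_divide field_simps)
    moreover have "2 / B - (1 / B)\<^sup>2 * w \<le> 1 / w"
    proof -
      have "0 \<le> (1 - w / B)\<^sup>2 / w" using w by simp
      also have "\<dots> = 1 / w - (2 / B - (1 / B)\<^sup>2 * w)"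
        using w B by (simp add: power2_eq_square field_simps)
      finally show ?thesis by simp
    qed
    ultimately have "q y * (2 / B - (1 / B)\<^sup>2 * w) \<le> q y * (p y / q y) powr \<alpha>"
      using dens_pos[OF q, of y] by (intro mult_left_mono) auto
    then show "2 / B * q y - (1 / B)\<^sup>2 * (q y * R y powr m) \<le> p y powr \<alpha> * q y powr (1 - \<alpha>)"
      unfolding hell_integrand[OF p q] by (simp add: w_def algebra_simps)
  qed
  finally show ?thesis .
qed

lemma dens_diff_integrable:
  assumes "dens p" "dens p'"
  shows "integrable L (\<lambda>y. \<bar>p y - p' y\<bar> * R y powr m)"
proof (rule Bochner_Integration.integrable_bound)
  show "integrable L (\<lambda>y. p y * R y powr m + p' y * R y powr m)"
    using assms by (simp add: dens_def)
  have [measurable]: "p \<in> borel_measurable L" "p' \<in> borel_measurable L"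
    using assms by (simp_all add: dens_def)
  show "(\<lambda>y. \<bar>p y - p' y\<bar> * R y powr m) \<in> borel_measurable L" by measurable
  have "\<bar>p y - p' y\<bar> \<le> p y + p' y" for y
    using dens_pos[OF assms(1), of y] dens_pos[OF assms(2), of y] by simp
  then show "AE y in L. norm (\<bar>p y - p' y\<bar> * R y powr m) \<le> norm (p y * R y powr m + p' y * R y powr m)"
    using dens_pos[OF assms(1), THEN less_imp_le] dens_pos[OF assms(2), THEN less_imp_le]
    by (auto simp: abs_mult simp flip: distrib_right intro!: mult_right_mono order_trans[OF _ abs_ge_self])
qed

lemma hell_diff_le:
  assumes p: "dens p" and q: "dens q" and p': "dens p'" and q': "dens q'"
  shows "\<bar>hell p q - hell p' q'\<bar>
    \<le> m * ((\<integral>y. \<bar>p y - p' y\<bar> * R y powr m \<partial>L) + (\<integral>y. \<bar>q y - q' y\<bar> * R y powr m \<partial>L))"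
proof -
  have "\<bar>hell p q - hell p' q'\<bar>
      = \<bar>\<integral>y. p y powr \<alpha> * q y powr (1 - \<alpha>) - p' y powr \<alpha> * q' y powr (1 - \<alpha>) \<partial>L\<bar>"
    unfolding hell_def using hell_integrable[OF p q] hell_integrable[OF p' q'] by simp
  also have "\<dots> \<le> (\<integral>y. \<bar>p y powr \<alpha> * q y powr (1 - \<alpha>) - p' y powr \<alpha> * q' y powr (1 - \<alpha>)\<bar> \<partial>L)"
    by (rule integral_abs_bound)
  also have "\<dots> \<le> (\<integral>y. m * (\<bar>p y - p' y\<bar> * R y powr m + \<bar>q y - q' y\<bar> * R y powr m) \<partial>L)"
    using hell_integrable[OF p q] hell_integrable[OF p' q'] dens_diff_integrable[OF p p']
      dens_diff_integrable[OF q q'] assms lo_pos R_ge \<alpha>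
    by (intro integral_mono hellinger_integrand_diff_le[where l = "lo _"]) (auto simp: dens_def m_def)
  also have "\<dots> = m * ((\<integral>y. \<bar>p y - p' y\<bar> * R y powr m \<partial>L) + (\<integral>y. \<bar>q y - q' y\<bar> * R y powr m \<partial>L))"
    using dens_diff_integrable[OF p p'] dens_diff_integrable[OF q q'] by simp
  finally show ?thesis .
qed

lemma ln_hell_diff_le:
  assumes p: "dens p" and q: "dens q" and p': "dens p'" and q': "dens q'"
  shows "\<bar>ln (hell p q) - ln (hell p' q')\<bar>
    \<le> B * (m * ((\<integral>y. \<bar>p y - p' y\<bar> * R y powr m \<partial>L) + (\<integral>y. \<bar>q y - q' y\<bar> * R y powr m \<partial>L)))"
proof -
  have ln_le: "ln a - ln b \<le> B * \<bar>a - b\<bar>" if "1 / B \<le> a" "1 / B \<le> b" for a b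
  proof -
    have "0 < 1 / B" using B by simp
    then have pos: "0 < a" "0 < b" using that by linarith+
    have "ln a - ln b \<le> (a - b) / b" using pos by (intro ln_diff_le)
    also have "\<dots> \<le> \<bar>a - b\<bar> / b" using pos by (intro divide_right_mono) auto
    also have "\<dots> \<le> \<bar>a - b\<bar> / (1 / B)" using that B pos by (intro divide_left_mono) auto
    finally show ?thesis by (simp add: mult.commute)
  qed
  have "\<bar>ln (hell p q) - ln (hell p' q')\<bar> \<le> B * \<bar>hell p q - hell p' q'\<bar>"
    using ln_le[OF hell_ge[OF p q] hell_ge[OF p' q']] ln_le[OF hell_ge[OF p' q'] hell_ge[OF p q]]
    by (simp add: abs_le_iff abs_minus_commute)
  also have "\<dots> \<le> B * (m * ((\<integral>y. \<bar>p y - p' y\<bar> * R y powr m \<partial>L) + (\<integral>y. \<bar>q y - q' y\<bar> * R y powr m \<partial>L)))"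
    using B hell_diff_le[OF assms] by (intro mult_left_mono) auto
  finally show ?thesis .
qed

end

section \<open>Smoothed empirical measures\<close>

text \<open>\<open>emp n X\<close> carries the power set as its \<sigma>-algebra and so is not a
  member of \<open>prob_ball d r\<close>. Its smoothed density is therefore handled through this
  finite sum. The condition on n makes the uniform distribution on the index set meaningful.\<close>

lemma conv_dens_emp:
  assumes "n \<ge> 1"
  shows "conv_dens d \<sigma> (emp n X) = (\<lambda>y. (\<Sum>i<n. gauss_dens d \<sigma> (\<lambda>j. y j - X i j)) / real n)"
proof -
  have "{..<n} \<noteq> {}" using assms by (auto simp: lessThan_empty_iff)
  then show ?thesis
    unfolding conv_dens_def emp_def by (simp add: integral_pmf_of_set fun_eq_iff)
qed

lemma integrable_of_nn_integral_le:
  fixes f :: "'a \<Rightarrow> real"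
  assumes "f \<in> borel_measurable L" "\<And>y. 0 \<le> f y" "(\<integral>\<^sup>+y. ennreal (f y) \<partial>L) \<le> ennreal c" "0 \<le> c"
  shows "integrable L f" "(\<integral>y. f y \<partial>L) \<le> c"
proof -
  show "integrable L f"
    using assms by (intro integrableI_nonneg) (auto intro: order_le_less_trans)
  show "(\<integral>y. f y \<partial>L) \<le> c"
    using assms by (subst integral_eq_nn_integral) (auto intro: enn2real_leI)
qed

lemma prob_ball_AE:
  assumes "M \<in> prob_ball d r"
  shows "AE x in M. enorm_d d x \<le> r"
proof -
  interpret prob_space M using assms by (simp add: prob_ball_def)
  have "AE x in M. x \<in> {x \<in> space M. enorm_d d x \<le> r}"
    using assms by (intro AE_prob_1) (simp add: prob_ball_def)
  then show ?thesis by eventually_elim auto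
qed

context comparable_densities
begin

lemma dens_average:
  assumes "n \<ge> 1" and p: "\<And>i. i < n \<Longrightarrow> dens (p i)"
  shows "dens (\<lambda>y. (\<Sum>i<n. p i y) / real n)"
  unfolding dens_def
proof (intro conjI allI)
  have [measurable]: "p i \<in> borel_measurable L" if "i < n" for i
    using p[OF that] by (simp add: dens_def)
  show "(\<lambda>y. (\<Sum>i<n. p i y) / real n) \<in> borel_measurable L" by measurable
  show "(\<Sum>i<n. p i y) / real n \<in> {lo y..lo y * R y}" for y
  proof -
    have "real (card {..<n}) * lo y \<le> (\<Sum>i<n. p i y)"
      using p by (intro sum_bounded_below) (auto simp: dens_def)
    moreover have "(\<Sum>i<n. p i y) \<le> real (card {..<n}) * (lo y * R y)"
      using p by (intro sum_bounded_above) (auto simp: dens_def)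
    ultimately show ?thesis
      using assms(1) by (simp add: field_simps)
  qed
  have int: "integrable L (p i)" "(\<integral>y. p i y \<partial>L) = 1" "integrable L (\<lambda>y. p i y * R y powr m)" if "i < n" for i
    using p[OF that] by (simp_all add: dens_def)
  show "integrable L (\<lambda>y. (\<Sum>i<n. p i y) / real n)"
    using int by (intro integrable_divide_zero Bochner_Integration.integrable_sum) auto
  show "(\<integral>y. (\<Sum>i<n. p i y) / real n \<partial>L) = 1"
    using int assms(1) by (simp add: Bochner_Integration.integral_sum)
  have eq: "(\<Sum>i<n. p i y) / real n * R y powr m = (\<Sum>i<n. p i y * R y powr m) / real n" for y
    by (simp add: sum_distrib_right)
  show "integrable L (\<lambda>y. (\<Sum>i<n. p i y) / real n * R y powr m)"
    unfolding eq using int by (intro integrable_divide_zero Bochner_Integration.integrable_sum) auto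
  have "(\<Sum>i<n. \<integral>y. p i y * R y powr m \<partial>L) \<le> real (card {..<n}) * B"
    using p by (intro sum_bounded_above) (auto simp: dens_def)
  then show "(\<integral>y. (\<Sum>i<n. p i y) / real n * R y powr m \<partial>L) \<le> B"
    unfolding eq using int assms(1) by (simp add: Bochner_Integration.integral_sum field_simps)
qed

end

section \<open>The constants and the weight for Gaussian smoothing\<close>

locale smoothing =
  fixes d :: nat and r \<sigma> \<alpha> :: real
  assumes d: "d \<ge> 1" and r: "r \<ge> 0" and \<sigma>: "\<sigma> > 0" and \<alpha>: "\<alpha> > 0"
begin

text \<open>The coefficient of the norm in the logarithm of the weight
  \<open>gauss_ratio d \<sigma> r y powr m\<close>. It is written with the maximum because
  \<open>m\<close> becomes available only after the sublocale below, which takes \<open>B\<close> as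
  a parameter.\<close>

definition \<kappa> :: real where
  "\<kappa> = 2 * max \<alpha> 1 * r / \<sigma>\<^sup>2"

text \<open>The first summand is the constant part of the log weight; the rest is the exponential
  moment with rate \<open>\<kappa>\<close> of a Gaussian whose centre has norm at most r.\<close>

definition B :: real where
  "B = exp (max \<alpha> 1 * r\<^sup>2 / (2 * \<sigma>\<^sup>2)
    + (\<kappa> * r + 3 / 2 * (\<kappa> * \<sigma> * sqrt (real d)) + (\<kappa> * \<sigma>)\<^sup>2))"

text \<open>The analogue of \<open>B\<close> for the envelope \<open>gauss_upper\<close>, a centred
  Gaussian times exp (r |y| / \<sigma>^2). The rate rises by r / \<sigma>^2, and the shift term
  disappears since the centre is 0.\<close>

definition T :: real where
  "T = exp (max \<alpha> 1 * r\<^sup>2 / (2 * \<sigma>\<^sup>2)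
    + (3 / 2 * ((\<kappa> + r / \<sigma>\<^sup>2) * \<sigma> * sqrt (real d)) + ((\<kappa> + r / \<sigma>\<^sup>2) * \<sigma>)\<^sup>2))"

lemma \<kappa>_nonneg: "\<kappa> \<ge> 0"
  using r by (simp add: \<kappa>_def)

sublocale comparable_densities "leb d" "gauss_lower d \<sigma> r" "gauss_ratio d \<sigma> r" \<alpha> B
proof
  show "0 < gauss_lower d \<sigma> r y" for y
    using \<sigma> by (simp add: gauss_lower_def)
  show "1 \<le> gauss_ratio d \<sigma> r y" for y
    using r by (simp add: gauss_ratio_def)
  show "gauss_ratio d \<sigma> r \<in> borel_measurable (leb d)"
    unfolding gauss_ratio_def[abs_def] by measurable
qed (use \<alpha> in \<open>auto simp: B_def\<close>)

definition W :: "(nat \<Rightarrow> real) \<Rightarrow> real" where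
  "W y = gauss_ratio d \<sigma> r y powr m"

lemma W_eq: "W y = exp (max \<alpha> 1 * r\<^sup>2 / (2 * \<sigma>\<^sup>2)) * exp (\<kappa> * enorm_d d y)"
proof -
  have "m * ((4 * r * enorm_d d y + r\<^sup>2) / (2 * \<sigma>\<^sup>2)) = m * r\<^sup>2 / (2 * \<sigma>\<^sup>2) + 2 * m * r / \<sigma>\<^sup>2 * enorm_d d y"
    by (simp add: add_divide_distrib distrib_left mult_ac)
  then show ?thesis
    unfolding W_def gauss_ratio_def \<kappa>_def m_def by (simp add: powr_def flip: exp_add)
qed

lemma W_pos: "0 < W y"
  by (simp add: W_eq)

lemma W_meas' [measurable]: "W \<in> borel_measurable (leb d)"
  unfolding W_eq[abs_def] by measurable

lemma gauss_W:
  assumes x: "enorm_d d x \<le> r"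
  shows "integrable (leb d) (\<lambda>y. gauss_dens d \<sigma> (\<lambda>i. y i - x i) * W y)"
    and "(\<integral>y. gauss_dens d \<sigma> (\<lambda>i. y i - x i) * W y \<partial>leb d) \<le> B"
proof -
  let ?c = "exp (max \<alpha> 1 * r\<^sup>2 / (2 * \<sigma>\<^sup>2))"
  have eq: "gauss_dens d \<sigma> (\<lambda>i. y i - x i) * W y
      = ?c * (gauss_dens d \<sigma> (\<lambda>i. y i - x i) * exp (\<kappa> * enorm_d d y))" for y
    by (simp add: W_eq)
  have "(\<integral>\<^sup>+y. ennreal (gauss_dens d \<sigma> (\<lambda>i. y i - x i) * W y) \<partial>leb d)
      = (\<integral>\<^sup>+y. ennreal ?c * ennreal (gauss_dens d \<sigma> (\<lambda>i. y i - x i) * exp (\<kappa> * enorm_d d y)) \<partial>leb d)"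
    by (simp only: eq ennreal_mult'[OF exp_ge_zero])
  also have "\<dots> = ennreal ?c * (\<integral>\<^sup>+y. ennreal (gauss_dens d \<sigma> (\<lambda>i. y i - x i) * exp (\<kappa> * enorm_d d y)) \<partial>leb d)"
    by (intro nn_integral_cmult) measurable
  also have "\<dots> \<le> ennreal ?c * ennreal (exp (\<kappa> * r + 3 / 2 * (\<kappa> * \<sigma> * sqrt (real d)) + (\<kappa> * \<sigma>)\<^sup>2))"
    by (intro mult_left_mono nn_integral_gauss_exp_norm_le \<sigma> d \<kappa>_nonneg x) auto
  also have "\<dots> = ennreal B"
    by (simp add: B_def flip: ennreal_mult' exp_add)
  finally have le: "(\<integral>\<^sup>+y. ennreal (gauss_dens d \<sigma> (\<lambda>i. y i - x i) * W y) \<partial>leb d) \<le> ennreal B" .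
  have nonneg: "0 \<le> gauss_dens d \<sigma> (\<lambda>i. y i - x i) * W y" for y
    using W_pos[of y] gauss_dens_pos[OF \<sigma>, of d "\<lambda>i. y i - x i"] by simp
  show "integrable (leb d) (\<lambda>y. gauss_dens d \<sigma> (\<lambda>i. y i - x i) * W y)"
    and "(\<integral>y. gauss_dens d \<sigma> (\<lambda>i. y i - x i) * W y \<partial>leb d) \<le> B"
    using integrable_of_nn_integral_le[OF _ nonneg le] B by auto
qed

lemma gauss_upper_W:
  shows "integrable (leb d) (\<lambda>y. gauss_upper d \<sigma> r y * W y)"
    and "(\<integral>y. gauss_upper d \<sigma> r y * W y \<partial>leb d) \<le> T"
proof -
  let ?c = "exp (max \<alpha> 1 * r\<^sup>2 / (2 * \<sigma>\<^sup>2))"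
  let ?\<kappa> = "\<kappa> + r / \<sigma>\<^sup>2"
  have \<kappa>': "?\<kappa> \<ge> 0" using \<kappa>_nonneg r by simp
  have zero: "enorm_d d (\<lambda>_. 0) \<le> 0" by (simp add: enorm_d_def)
  have gu [measurable]: "gauss_upper d \<sigma> r \<in> borel_measurable (leb d)"
    using gauss_dens_shift_meas_leb[of d \<sigma> "\<lambda>_. 0"] unfolding gauss_upper_def[abs_def] by simp
  have [measurable]: "gauss_dens d \<sigma> \<in> borel_measurable (leb d)"
    using gauss_dens_shift_meas_leb[of d \<sigma> "\<lambda>_. 0"] by simp
  have "(\<kappa> + r / \<sigma>\<^sup>2) * e = \<kappa> * e + r * e / \<sigma>\<^sup>2" for e
    by (simp add: distrib_right)
  then have eq: "gauss_upper d \<sigma> r y * W y = ?c * (gauss_dens d \<sigma> y * exp (?\<kappa> * enorm_d d y))" for y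
    by (simp add: W_eq gauss_upper_def exp_add)
  have "(\<integral>\<^sup>+y. ennreal (gauss_upper d \<sigma> r y * W y) \<partial>leb d)
      = (\<integral>\<^sup>+y. ennreal ?c * ennreal (gauss_dens d \<sigma> y * exp (?\<kappa> * enorm_d d y)) \<partial>leb d)"
    by (simp only: eq ennreal_mult'[OF exp_ge_zero])
  also have "\<dots> = ennreal ?c * (\<integral>\<^sup>+y. ennreal (gauss_dens d \<sigma> y * exp (?\<kappa> * enorm_d d y)) \<partial>leb d)"
    by (intro nn_integral_cmult) measurable
  also have "\<dots> \<le> ennreal ?c * ennreal (exp (3 / 2 * (?\<kappa> * \<sigma> * sqrt (real d)) + (?\<kappa> * \<sigma>)\<^sup>2))"
    using nn_integral_gauss_exp_norm_le[OF \<sigma> d \<kappa>' zero] by (intro mult_left_mono) auto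
  also have "\<dots> = ennreal T"
    by (simp add: T_def flip: ennreal_mult' exp_add)
  finally have le: "(\<integral>\<^sup>+y. ennreal (gauss_upper d \<sigma> r y * W y) \<partial>leb d) \<le> ennreal T" .
  have nonneg: "0 \<le> gauss_upper d \<sigma> r y * W y" for y
    using W_pos[of y] gauss_dens_pos[OF \<sigma>, of d y] by (simp add: gauss_upper_def)
  show "integrable (leb d) (\<lambda>y. gauss_upper d \<sigma> r y * W y)"
    and "(\<integral>y. gauss_upper d \<sigma> r y * W y \<partial>leb d) \<le> T"
    using integrable_of_nn_integral_le[OF _ nonneg le] by (auto simp: T_def)
qed

lemma dens_gauss:
  assumes x: "enorm_d d x \<le> r"
  shows "dens (\<lambda>y. gauss_dens d \<sigma> (\<lambda>i. y i - x i))"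
proof -
  have "has_bochner_integral (leb d) (\<lambda>y. gauss_dens d \<sigma> (\<lambda>i. y i - x i)) 1"
    using nn_integral_gauss_dens[OF \<sigma>, of d x] gauss_dens_pos[OF \<sigma>, THEN less_imp_le]
    by (intro has_bochner_integral_nn_integral) auto
  then show ?thesis
    using gauss_W[OF x] gauss_dens_bounds[OF \<sigma> x]
    unfolding dens_def W_def by (auto simp: gauss_upper_eq[OF \<sigma>] has_bochner_integral_iff)
qed

lemma dens_emp:
  assumes "n \<ge> 1" "\<And>i. i < n \<Longrightarrow> enorm_d d (X i) \<le> r"
  shows "dens (conv_dens d \<sigma> (emp n X))"
  unfolding conv_dens_emp[OF assms(1)] using assms by (intro dens_average dens_gauss) auto

text \<open>Truncating the kernel makes the bounds of \<open>weighted_kernel\<close> hold everywhere and not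
  only almost everywhere.\<close>
definition ball_kernel :: "(nat \<Rightarrow> real) \<Rightarrow> (nat \<Rightarrow> real) \<Rightarrow> real" where
  "ball_kernel x y = (if enorm_d d x \<le> r then gauss_dens d \<sigma> (\<lambda>i. y i - x i) else 0)"

lemma weighted_kernel_ball:
  assumes M: "M \<in> prob_ball d r"
  shows "weighted_kernel M (leb d) ball_kernel (gauss_upper d \<sigma> r) W B"
proof -
  interpret prob_space M using M by (simp add: prob_ball_def)
  interpret L: sigma_finite_measure "leb d" by (rule sigma_finite_leb)
  have sets: "sets M = sets (borel_d d)" using M by (simp add: prob_ball_def)
  have [measurable]: "enorm_d d \<in> borel_measurable M"
    using enorm_d_meas_borel_d sets by (simp cong: measurable_cong_sets)
  show ?thesis
  proof
    show "(\<lambda>(x, y). ball_kernel x y) \<in> borel_measurable (M \<Otimes>\<^sub>M leb d)"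
      using gauss_dens_meas[OF sets, of \<sigma>] unfolding ball_kernel_def case_prod_unfold by measurable
    show "gauss_upper d \<sigma> r \<in> borel_measurable (leb d)"
      using gauss_dens_shift_meas_leb[of d \<sigma> "\<lambda>_. 0"] unfolding gauss_upper_def[abs_def] by simp
    show "0 \<le> ball_kernel x y \<and> ball_kernel x y \<le> gauss_upper d \<sigma> r y" for x y
    proof -
      have "0 \<le> gauss_upper d \<sigma> r y"
        using gauss_dens_pos[OF \<sigma>, of d y] by (simp add: gauss_upper_def)
      then show ?thesis
        using gauss_dens_bounds(2)[OF \<sigma>, of d x r y] gauss_dens_pos[OF \<sigma>, THEN less_imp_le]
        by (simp add: ball_kernel_def)
    qed
    show "(\<integral>y. ball_kernel x y * W y \<partial>leb d) \<le> B" for x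
      using gauss_W(2)[of x] B by (cases "enorm_d d x \<le> r") (simp_all add: ball_kernel_def)
  qed (use gauss_upper_W W_pos B in \<open>auto intro: less_imp_le\<close>)
qed

text \<open>The points cut off by the truncation form a null set of \<open>M\<close>, so for each
  fixed y the integral over the centres is unchanged. The equality thus holds at every y.\<close>

lemma conv_dens_eq_mean:
  assumes M: "M \<in> prob_ball d r"
  shows "conv_dens d \<sigma> M = weighted_kernel.mean_G M ball_kernel"
proof
  interpret weighted_kernel M "leb d" ball_kernel "gauss_upper d \<sigma> r" W B
    by (rule weighted_kernel_ball[OF M])
  have sets: "sets M = sets (borel_d d)" using M by (simp add: prob_ball_def)
  have [measurable]: "enorm_d d \<in> borel_measurable M"
    using enorm_d_meas_borel_d sets by (simp cong: measurable_cong_sets)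
  fix y
  note gauss_dens_shift_meas[OF sets, of \<sigma> y, measurable]
  show "conv_dens d \<sigma> M y = mean_G y"
    unfolding conv_dens_def mean_G_def using prob_ball_AE[OF M]
    by (intro integral_cong_AE) (auto simp: ball_kernel_def elim!: eventually_mono)
qed

lemma dens_conv:
  assumes M: "M \<in> prob_ball d r"
  shows "dens (conv_dens d \<sigma> M)"
proof -
  interpret weighted_kernel M "leb d" ball_kernel "gauss_upper d \<sigma> r" W B
    by (rule weighted_kernel_ball[OF M])
  have sets: "sets M = sets (borel_d d)" using M by (simp add: prob_ball_def)
  have bounds: "conv_dens d \<sigma> M y \<in> {gauss_lower d \<sigma> r y..gauss_upper d \<sigma> r y}" for y
  proof -
    note gauss_dens_shift_meas[OF sets, of \<sigma> y, measurable]
    have AE: "AE x in M. gauss_lower d \<sigma> r y \<le> gauss_dens d \<sigma> (\<lambda>i. y i - x i) \<and>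
        gauss_dens d \<sigma> (\<lambda>i. y i - x i) \<le> gauss_upper d \<sigma> r y"
      using prob_ball_AE[OF M] by eventually_elim (use gauss_dens_bounds[OF \<sigma>] in auto)
    have int: "integrable M (\<lambda>x. gauss_dens d \<sigma> (\<lambda>i. y i - x i))"
      using AE gauss_dens_pos[OF \<sigma>, THEN less_imp_le]
      by (intro M.integrable_const_bound[of _ "gauss_upper d \<sigma> r y"]) (auto elim!: eventually_mono)
    show ?thesis
      unfolding conv_dens_def using AE
      by (auto intro!: M.integral_ge_const[OF int] M.integral_le_const[OF int] elim!: eventually_mono)
  qed
  \<comment> \<open>Tonelli without weight: the mixture of densities of mass one has mass
    one.\<close>
  have "(\<integral>\<^sup>+y. ennreal (mean_G y * 1) \<partial>leb d) = (\<integral>\<^sup>+x. (\<integral>\<^sup>+y. ennreal (ball_kernel x y * 1) \<partial>leb d) \<partial>M)"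
    by (intro nn_integral_mean_G) auto
  also have "\<dots> = (\<integral>\<^sup>+x. 1 \<partial>M)"
    using prob_ball_AE[OF M] nn_integral_gauss_dens[OF \<sigma>]
    by (intro nn_integral_cong_AE) (auto simp: ball_kernel_def elim!: eventually_mono)
  finally have "(\<integral>\<^sup>+y. ennreal (mean_G y) \<partial>leb d) = 1"
    by (simp add: M.emeasure_space_1)
  then have "has_bochner_integral (leb d) mean_G 1"
    using mean_G_bounds by (intro has_bochner_integral_nn_integral) auto
  then show ?thesis
    using bounds mean_GW_int mean_GW_le unfolding dens_def W_def[symmetric] gauss_upper_eq[OF \<sigma>, symmetric]
    by (auto simp: conv_dens_eq_mean[OF M] has_bochner_integral_iff)
qed

lemma deviation_eq:
  assumes M: "M \<in> prob_ball d r" and n: "n \<ge> 1" and X: "\<And>i. i < n \<Longrightarrow> enorm_d d (X i) \<le> r"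
  shows "weighted_kernel.deviation M (leb d) ball_kernel W n X
    = (\<integral>y. \<bar>conv_dens d \<sigma> (emp n X) y - conv_dens d \<sigma> M y\<bar> * gauss_ratio d \<sigma> r y powr m \<partial>leb d)"
proof -
  interpret weighted_kernel M "leb d" ball_kernel "gauss_upper d \<sigma> r" W B
    by (rule weighted_kernel_ball[OF M])
  show ?thesis
    unfolding deviation_def conv_dens_emp[OF n] conv_dens_eq_mean[OF M] W_def[symmetric]
    using X by (simp add: ball_kernel_def)
qed

text \<open>The exceptional set collects large deviations together with the null event that some
  point leaves the ball, so everything outside it holds pointwise. Providing a measurable set,
  rather than the measure of an event, spares a measurability proof for the divergence of the
  empirical measures. The scale sqrt 2 * B * z makes the exponent exactly n z^2.\<close>

lemma sample_tail:
  assumes M: "M \<in> prob_ball d r" and n: "n \<ge> 1" and z: "z \<ge> 0"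
  defines "P \<equiv> PiM {..<n} (\<lambda>_. M)"
  shows "\<exists>S\<in>sets P. measure P S \<le> exp (- (real n * z\<^sup>2)) \<and>
    (\<forall>X\<in>space P - S. (\<forall>i<n. enorm_d d (X i) \<le> r) \<and>
      (\<integral>y. \<bar>conv_dens d \<sigma> (emp n X) y - conv_dens d \<sigma> M y\<bar> * gauss_ratio d \<sigma> r y powr m \<partial>leb d)
        < T / sqrt (real n) + sqrt 2 * B * z)"
proof -
  interpret weighted_kernel M "leb d" ball_kernel "gauss_upper d \<sigma> r" W B
    by (rule weighted_kernel_ball[OF M])
  interpret P: prob_space P
    unfolding P_def by (intro prob_space_PiM M.prob_space_axioms)
  have sets: "sets M = sets (borel_d d)" using M by (simp add: prob_ball_def)
  have enorm: "enorm_d d \<in> borel_measurable M"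
    using enorm_d_meas_borel_d sets by (simp cong: measurable_cong_sets)
  have [measurable]: "deviation n \<in> borel_measurable P"
    unfolding P_def by measurable
  let ?t = "T / sqrt (real n) + sqrt 2 * B * z"
  define S where "S = {X \<in> space P. \<not> ((\<forall>i<n. enorm_d d (X i) \<le> r) \<and> deviation n X < ?t)}"
  have comp: "(\<lambda>X. enorm_d d (X i)) \<in> borel_measurable P" if "i < n" for i
    unfolding P_def using that by (intro measurable_compose[OF _ enorm] measurable_component_singleton) auto
  have S: "S \<in> sets P"
    unfolding S_def using comp by measurable
  have "AE X in P. \<forall>i\<in>{..<n}. enorm_d d (X i) \<le> r"
    unfolding P_def using prob_ball_AE[OF M]
    by (intro eventually_ball_finite ballI AE_PiM_component) (auto simp: M.prob_space_axioms)
  moreover have "?t \<ge> (\<integral>y. gauss_upper d \<sigma> r y * W y \<partial>leb d) / sqrt (real n) + sqrt 2 * B * z"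
    using gauss_upper_W(2) by (simp add: divide_right_mono)
  ultimately have "AE X in P. X \<in> S \<longrightarrow> X \<in> {X \<in> space P. deviation n X \<ge>
      (\<integral>y. gauss_upper d \<sigma> r y * W y \<partial>leb d) / sqrt (real n) + sqrt 2 * B * z}"
    by (auto simp: S_def elim!: eventually_mono)
  then have "measure P S \<le> measure P {X \<in> space P. deviation n X \<ge>
      (\<integral>y. gauss_upper d \<sigma> r y * W y \<partial>leb d) / sqrt (real n) + sqrt 2 * B * z}"
    by (intro P.finite_measure_mono_AE) measurable
  also have "\<dots> \<le> exp (- real n * (sqrt 2 * B * z)\<^sup>2 / (2 * B\<^sup>2))"
    unfolding P_def using n z B by (intro deviation_tail) auto
  also have "- real n * (sqrt 2 * B * z)\<^sup>2 / (2 * B\<^sup>2) = - (real n * z\<^sup>2)"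
    using B by (simp add: power_mult_distrib)
  finally show ?thesis
  proof (intro bexI[OF _ S] conjI ballI)
    fix X assume "X \<in> space P - S"
    then have X: "\<forall>i<n. enorm_d d (X i) \<le> r" and dev: "deviation n X < ?t"
      by (auto simp: S_def)
    have "deviation n X = (\<integral>y. \<bar>conv_dens d \<sigma> (emp n X) y - conv_dens d \<sigma> M y\<bar>
        * gauss_ratio d \<sigma> r y powr m \<partial>leb d)"
      using X by (intro deviation_eq M n) auto
    with dev show "(\<integral>y. \<bar>conv_dens d \<sigma> (emp n X) y - conv_dens d \<sigma> M y\<bar>
        * gauss_ratio d \<sigma> r y powr m \<partial>leb d) < ?t"
      by simp
    show "\<forall>i<n. enorm_d d (X i) \<le> r" by (rule X)
  qed
qed

end

section \<open>The concentration bound\<close>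

text \<open>Each of the three factors is at least 1. Hence a bound for \<open>B * T\<close> by the
  exponential in \<open>lambda_const\<close> may be multiplied by \<open>xi_tilde\<close>.\<close>

lemma xi_tilde_ge_1:
  assumes "d \<ge> 1" "r \<ge> 0" "0 < \<sigma>" "\<sigma> \<le> 1"
  shows "1 \<le> xi_tilde r d \<sigma>"
proof -
  have "1 * 1 \<le> exp 1 * real d"
    using assms by (intro mult_mono) auto
  then have "1 \<le> (3 * exp 1 * real d) ^ (3 * (d + 2))"
    by (intro one_le_power) linarith
  moreover have "1 \<le> (r + 1) powr (real d / 2 + 1)"
    using assms by (intro ge_one_powr_ge_zero) auto
  moreover have "1 \<le> \<sigma> powr (- real d / 2)"
  proof -
    have "\<sigma> powr 0 \<le> \<sigma> powr (- real d / 2)"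
      using assms by (intro powr_mono') auto
    then show ?thesis using assms by simp
  qed
  ultimately have "1 * 1 * 1 \<le> xi_tilde r d \<sigma>"
    unfolding xi_tilde_def by (intro mult_mono) auto
  then show ?thesis by simp
qed

section \<open>Comparison of the constants with lambda\<close>

definition lambda_expo :: "real \<Rightarrow> nat \<Rightarrow> real \<Rightarrow> real \<Rightarrow> real" where
  "lambda_expo \<alpha> d r \<sigma> =
    (\<alpha> + 1) * b_const r \<sigma> * (1 + r + sqrt (real d) * \<sigma> / 2 + real d * (\<alpha> + 1) * b_const r \<sigma> * \<sigma>\<^sup>2)"

context smoothing
begin

text \<open>With \<rho> = r / \<sigma>, u = m \<rho>, w = m \<rho>^2 and D = sqrt d, the exponents
  of B^2 and B T are at most 5 w + 6 u D + 8 u^2 and 3 w + 15/2 u D + 13 u^2. The exponent of lambda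
  is at least 5 w + 16 y^2 with y = (\<alpha> + 1) \<rho> D \<ge> u D \<ge> u. The surplus of 16 y^2
  over the quadratic terms pays for the linear ones up to the constant 5.\<close>

lemma constants_le:
  shows "B * B \<le> exp 5 * exp (lambda_expo \<alpha> d r \<sigma>)"
    and "B * T \<le> exp 5 * exp (lambda_expo \<alpha> d r \<sigma>)"
proof -
  define \<rho> where "\<rho> = r / \<sigma>"
  define D where "D = sqrt (real d)"
  define b where "b = b_const r \<sigma>"
  define y where "y = (\<alpha> + 1) * \<rho> * D"
  have m: "1 \<le> m" "m \<le> \<alpha> + 1" using \<alpha> by (auto simp: m_def)
  have D: "1 \<le> D" using d by (simp add: D_def)
  have \<rho>: "0 \<le> \<rho>" using r \<sigma> by (simp add: \<rho>_def)
  have b_eq: "b * \<sigma>\<^sup>2 = r\<^sup>2 + 4 * r" and b0: "0 \<le> b"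
    using \<sigma> r by (simp_all add: b_def b_const_def)
  have E: "5 * (\<alpha> + 1) * \<rho>\<^sup>2 + 16 * y\<^sup>2 \<le> lambda_expo \<alpha> d r \<sigma>"
  proof -
    \<comment> \<open>The product is r^3 + 5 r^2 + 4 r. This term of the exponent supplies the
      multiple of \<rho>^2; the summand with factor d, a perfect square since b \<sigma> \<ge> 4
      \<rho>, supplies 16 y^2.\<close>
    have "5 * r\<^sup>2 \<le> (r\<^sup>2 + 4 * r) * (1 + r)"
      using r by (simp add: power2_eq_square algebra_simps)
    then have "5 * \<rho>\<^sup>2 \<le> b * (1 + r)"
      using \<sigma> by (simp add: \<rho>_def b_def b_const_def power_divide divide_right_mono)
    also have "\<dots> \<le> b * (1 + r + D * \<sigma> / 2)"
      using b0 D \<sigma> by (intro mult_left_mono) auto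
    finally have 1: "(\<alpha> + 1) * (5 * \<rho>\<^sup>2) \<le> (\<alpha> + 1) * (b * (1 + r + D * \<sigma> / 2))"
      using \<alpha> by (intro mult_left_mono) auto
    have "4 * \<rho> \<le> b * \<sigma>"
    proof -
      have "4 * r / \<sigma> \<le> (r\<^sup>2 + 4 * r) / \<sigma>" using \<sigma> by (intro divide_right_mono) auto
      also have "\<dots> = b * \<sigma>" using \<sigma> by (simp add: b_def b_const_def power2_eq_square)
      finally show ?thesis by (simp add: \<rho>_def)
    qed
    then have "((\<alpha> + 1) * D * (4 * \<rho>))\<^sup>2 \<le> ((\<alpha> + 1) * D * (b * \<sigma>))\<^sup>2"
      using \<alpha> D \<rho> by (intro power_mono mult_left_mono) auto
    moreover have "((\<alpha> + 1) * D * (4 * \<rho>))\<^sup>2 = 16 * y\<^sup>2"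
      unfolding y_def by (simp add: power_mult_distrib)
    moreover have "((\<alpha> + 1) * D * (b * \<sigma>))\<^sup>2 = (\<alpha> + 1) * b * (D\<^sup>2 * (\<alpha> + 1) * b * \<sigma>\<^sup>2)"
      by (simp only: power2_eq_square mult_ac)
    ultimately have 2: "16 * y\<^sup>2 \<le> (\<alpha> + 1) * b * (D\<^sup>2 * (\<alpha> + 1) * b * \<sigma>\<^sup>2)"
      by simp
    have "D\<^sup>2 = real d" by (simp add: D_def)
    then have "lambda_expo \<alpha> d r \<sigma> = (\<alpha> + 1) * (b * (1 + r + D * \<sigma> / 2))
        + (\<alpha> + 1) * b * (D\<^sup>2 * (\<alpha> + 1) * b * \<sigma>\<^sup>2)"
      unfolding lambda_expo_def b_def[symmetric] D_def[symmetric] by (simp only: distrib_left mult.assoc)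
    moreover have "(\<alpha> + 1) * (5 * \<rho>\<^sup>2) = 5 * (\<alpha> + 1) * \<rho>\<^sup>2"
      by (simp only: mult_ac)
    ultimately show ?thesis using 1 2 by linarith
  qed
  define u where "u = m * \<rho>"
  define w where "w = m * \<rho>\<^sup>2"
  have u: "0 \<le> u" and w: "0 \<le> w" using m \<rho> by (simp_all add: u_def w_def)
  have uD: "u * D \<le> y"
    unfolding y_def u_def by (intro mult_right_mono m \<rho>) (use D in linarith)
  have w_le: "5 * w \<le> 5 * (\<alpha> + 1) * \<rho>\<^sup>2"
    unfolding w_def mult.assoc[of 5] by (intro mult_left_mono mult_right_mono m zero_le_power2) simp
  have "u * 1 \<le> u * D"
    by (intro mult_left_mono D u)
  with uD have "u \<le> y" by simp
  then have u2: "u\<^sup>2 \<le> y\<^sup>2"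
    by (intro power_mono u)
  have \<kappa>\<sigma>: "\<kappa> * \<sigma> = 2 * u"
    using \<sigma> by (simp add: \<kappa>_def m_def \<rho>_def u_def power2_eq_square)
  have \<kappa>r: "\<kappa> * r = 2 * w" and mr2: "m * r\<^sup>2 / (2 * \<sigma>\<^sup>2) = w / 2"
    by (simp_all add: \<kappa>_def m_def \<rho>_def w_def power2_eq_square)
  have "r / \<sigma>\<^sup>2 * \<sigma> = \<rho>"
    using \<sigma> by (simp add: \<rho>_def power2_eq_square)
  then have \<kappa>': "(\<kappa> + r / \<sigma>\<^sup>2) * \<sigma> = 2 * u + \<rho>"
    using \<kappa>\<sigma> by (simp only: distrib_right)
  have B_eq: "B = exp (5 / 2 * w + 3 * (u * D) + 4 * u\<^sup>2)"
    unfolding B_def m_def[symmetric] \<kappa>\<sigma> \<kappa>r mr2 D_def[symmetric]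
    by (simp add: power_mult_distrib)
  \<comment> \<open>Since m \<ge> 1, the additional rate of the envelope is at most u, so the rate 2
    u in \<open>B\<close> becomes at most 3 u in \<open>T\<close>.\<close>
  have "\<rho> \<le> u"
    using mult_right_mono[OF m(1) \<rho>] by (simp add: u_def)
  then have le: "2 * u + \<rho> \<le> 3 * u" and ge: "0 \<le> 2 * u + \<rho>" using u \<rho> by simp_all
  have "(2 * u + \<rho>)\<^sup>2 \<le> (3 * u)\<^sup>2"
    by (intro power_mono le ge)
  moreover have "(3 * u)\<^sup>2 = 9 * u\<^sup>2" by (simp add: power_mult_distrib)
  moreover have "(2 * u + \<rho>) * D \<le> 3 * u * D"
    by (intro mult_right_mono le) (use D in linarith)
  moreover have "3 * u * D = 3 * (u * D)" by (simp only: mult.assoc)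
  ultimately have T_le: "T \<le> exp (w / 2 + (9 / 2 * (u * D) + 9 * u\<^sup>2))"
    unfolding T_def m_def[symmetric] \<kappa>' mr2 D_def[symmetric] exp_le_cancel_iff by linarith
  \<comment> \<open>Completing the squares in 3 y^2 - 15/2 y and 8 y^2 - 6 y leaves the constants
    75/16 and 9/8, both below 5.\<close>
  have "0 \<le> 3 * (y - 5 / 4)\<^sup>2" "0 \<le> 8 * (y - 3 / 8)\<^sup>2" by simp_all
  then have lin: "15 / 2 * y + 13 * y\<^sup>2 \<le> 16 * y\<^sup>2 + 5" "6 * y + 8 * y\<^sup>2 \<le> 16 * y\<^sup>2 + 5"
    unfolding power2_diff by (simp_all add: power2_eq_square)
  have "B * B = exp (5 * w + 6 * (u * D) + 8 * u\<^sup>2)"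
    unfolding B_eq exp_add[symmetric] by simp
  also have "\<dots> \<le> exp (5 + lambda_expo \<alpha> d r \<sigma>)"
    unfolding exp_le_cancel_iff using E w_le uD u2 lin(2) by linarith
  finally show "B * B \<le> exp 5 * exp (lambda_expo \<alpha> d r \<sigma>)" by (simp add: exp_add)
  have "B * T \<le> B * exp (w / 2 + (9 / 2 * (u * D) + 9 * u\<^sup>2))"
    using T_le B by (intro mult_left_mono) auto
  also have "\<dots> = exp (3 * w + 15 / 2 * (u * D) + 13 * u\<^sup>2)"
    unfolding B_eq exp_add[symmetric] by simp
  also have "\<dots> \<le> exp (5 + lambda_expo \<alpha> d r \<sigma>)"
    unfolding exp_le_cancel_iff using E w_le uD u2 lin(1) w by linarith
  finally show "B * T \<le> exp 5 * exp (lambda_expo \<alpha> d r \<sigma>)" by (simp add: exp_add)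
qed

text \<open>Outside the two exceptional sets each weighted deviation is below \<tau>, and the
  Lipschitz bound for the logarithm divided by |\<alpha> - 1| stays strictly below the threshold.
  The union bound over the sets gives the factor 2.\<close>

lemma renyi_concentration:
  assumes "\<sigma> \<le> 1" "\<alpha> \<noteq> 1" and n: "n \<ge> 1" and z: "z \<ge> 0"
    and M: "M \<in> prob_ball d r" and N: "N \<in> prob_ball d r"
  shows "measure (sample_space n M N)
      {\<omega> \<in> space (sample_space n M N).
        \<bar>renyi_smooth \<alpha> d \<sigma> (emp n (fst \<omega>)) (emp n (snd \<omega>)) - renyi_smooth \<alpha> d \<sigma> M N\<bar>
          \<ge> 4 * exp 5 * lambda_const \<alpha> d r \<sigma> * (xi_tilde r d \<sigma> / sqrt (real n) + z)}
    \<le> 2 * exp (- (real n * z\<^sup>2))"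
proof -
  define P where "P = PiM {..<n} (\<lambda>_. M)"
  define Q where "Q = PiM {..<n} (\<lambda>_. N)"
  define \<tau> where "\<tau> = T / sqrt (real n) + sqrt 2 * B * z"
  define dev where "dev M X = (\<integral>y. \<bar>conv_dens d \<sigma> (emp n X) y - conv_dens d \<sigma> M y\<bar>
    * gauss_ratio d \<sigma> r y powr m \<partial>leb d)" for M X
  interpret P: prob_space P
    unfolding P_def using M by (intro prob_space_PiM) (simp add: prob_ball_def)
  interpret Q: prob_space Q
    unfolding Q_def using N by (intro prob_space_PiM) (simp add: prob_ball_def)
  interpret PQ: pair_prob_space P Q ..
  have ss: "sample_space n M N = P \<Otimes>\<^sub>M Q"
    by (simp add: sample_space_def P_def Q_def)
  obtain S1 where S1: "S1 \<in> sets P" "measure P S1 \<le> exp (- (real n * z\<^sup>2))"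
    and S1': "\<And>X. X \<in> space P - S1 \<Longrightarrow> (\<forall>i<n. enorm_d d (X i) \<le> r) \<and> dev M X < \<tau>"
    using sample_tail[OF M n z] unfolding P_def[symmetric] \<tau>_def[symmetric] dev_def[symmetric] by blast
  obtain S2 where S2: "S2 \<in> sets Q" "measure Q S2 \<le> exp (- (real n * z\<^sup>2))"
    and S2': "\<And>Y. Y \<in> space Q - S2 \<Longrightarrow> (\<forall>i<n. enorm_d d (Y i) \<le> r) \<and> dev N Y < \<tau>"
    using sample_tail[OF N n z] unfolding Q_def[symmetric] \<tau>_def[symmetric] dev_def[symmetric] by blast
  define thr where "thr = 4 * exp 5 * lambda_const \<alpha> d r \<sigma> * (xi_tilde r d \<sigma> / sqrt (real n) + z)"
  have renyi: "renyi_smooth \<alpha> d \<sigma> M' N' = ln (hell (conv_dens d \<sigma> M') (conv_dens d \<sigma> N')) / (\<alpha> - 1)" for M' N'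
    by (simp add: renyi_smooth_def renyi_dens_def hell_def)
  \<comment> \<open>Origin of \<open>4 * exp 5\<close>: one factor 2 from adding the deviations of
    both samples, one from sqrt 2 \<le> 2, and \<open>exp 5\<close> from the comparison of
    constants.\<close>
  have thr_ge: "B * (m * (2 * \<tau>)) / \<bar>\<alpha> - 1\<bar> \<le> thr"
  proof -
    let ?E = "exp (lambda_expo \<alpha> d r \<sigma>)"
    have xi: "1 \<le> xi_tilde r d \<sigma>"
      using d r \<sigma> \<open>\<sigma> \<le> 1\<close> by (rule xi_tilde_ge_1)
    have "B * \<tau> = B * T / sqrt (real n) + sqrt 2 * (B * B) * z"
      by (simp add: \<tau>_def algebra_simps)
    also have "\<dots> \<le> exp 5 * ?E * xi_tilde r d \<sigma> / sqrt (real n) + 2 * (exp 5 * ?E) * z"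
    proof -
      have "B * T \<le> exp 5 * ?E * 1" using constants_le(2) by simp
      also have "\<dots> \<le> exp 5 * ?E * xi_tilde r d \<sigma>" using xi by (intro mult_left_mono) auto
      finally have BT: "B * T / sqrt (real n) \<le> exp 5 * ?E * xi_tilde r d \<sigma> / sqrt (real n)"
        by (intro divide_right_mono) auto
      have "sqrt 2 \<le> (2::real)" by (simp add: real_le_lsqrt)
      then have "sqrt 2 * (B * B) \<le> 2 * (exp 5 * ?E)"
        by (rule mult_mono[OF _ constants_le(1)]) (use B in simp_all)
      from add_mono[OF BT mult_right_mono[OF this z]] show ?thesis .
    qed
    also have "\<dots> \<le> 2 * (exp 5 * ?E) * (xi_tilde r d \<sigma> / sqrt (real n) + z)"
    proof -
      have "0 \<le> exp 5 * ?E * xi_tilde r d \<sigma> / sqrt (real n)" using xi by simp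
      then show ?thesis by (simp add: algebra_simps)
    qed
    finally have B\<tau>: "B * \<tau> \<le> 2 * (exp 5 * ?E) * (xi_tilde r d \<sigma> / sqrt (real n) + z)" .
    \<comment> \<open>Equivalent to m \<le> \<alpha> + |\<alpha> - 1|, with equality for \<alpha> <
      1. This accounts for the prefactor of lambda.\<close>
    have pref: "m / \<bar>\<alpha> - 1\<bar> \<le> \<alpha> / \<bar>\<alpha> - 1\<bar> + 1"
      using \<alpha> \<open>\<alpha> \<noteq> 1\<close> by (auto simp: m_def max_def abs_if field_simps)
    have "0 \<le> m / \<bar>\<alpha> - 1\<bar>" using \<alpha> by (simp add: m_def le_max_iff_disj)
    have rhs0: "0 \<le> 2 * (exp 5 * ?E) * (xi_tilde r d \<sigma> / sqrt (real n) + z)"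
      using xi z by simp
    have "B * (m * (2 * \<tau>)) / \<bar>\<alpha> - 1\<bar> = m / \<bar>\<alpha> - 1\<bar> * (2 * (B * \<tau>))"
      by simp
    also have "\<dots> \<le> m / \<bar>\<alpha> - 1\<bar> * (2 * (2 * (exp 5 * ?E) * (xi_tilde r d \<sigma> / sqrt (real n) + z)))"
      using B\<tau> \<open>0 \<le> m / \<bar>\<alpha> - 1\<bar>\<close> by (intro mult_left_mono) auto
    also have "\<dots> \<le> (\<alpha> / \<bar>\<alpha> - 1\<bar> + 1) * (2 * (2 * (exp 5 * ?E) * (xi_tilde r d \<sigma> / sqrt (real n) + z)))"
      using pref rhs0 by (intro mult_right_mono) auto
    also have "\<dots> = thr"
      unfolding thr_def lambda_const_def lambda_expo_def by simp
    finally show ?thesis .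
  qed
  have good: "\<bar>renyi_smooth \<alpha> d \<sigma> (emp n X) (emp n Y) - renyi_smooth \<alpha> d \<sigma> M N\<bar> < thr"
    if X: "X \<in> space P - S1" and Y: "Y \<in> space Q - S2" for X Y
  proof -
    let ?p = "conv_dens d \<sigma>"
    have "\<bar>ln (hell (?p (emp n X)) (?p (emp n Y))) - ln (hell (?p M) (?p N))\<bar>
        \<le> B * (m * (dev M X + dev N Y))"
      unfolding dev_def using S1'[OF X] S2'[OF Y]
      by (intro ln_hell_diff_le dens_emp dens_conv M N n) auto
    also have "\<dots> < B * (m * (2 * \<tau>))"
      using S1'[OF X] S2'[OF Y] B \<alpha> by (intro mult_strict_left_mono) (auto simp: m_def)
    finally have "\<bar>ln (hell (?p (emp n X)) (?p (emp n Y))) - ln (hell (?p M) (?p N))\<bar> / \<bar>\<alpha> - 1\<bar>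
        < B * (m * (2 * \<tau>)) / \<bar>\<alpha> - 1\<bar>"
      using \<open>\<alpha> \<noteq> 1\<close> by (intro divide_strict_right_mono) auto
    with thr_ge show ?thesis
      by (simp add: renyi flip: diff_divide_distrib)
  qed
  have "measure (P \<Otimes>\<^sub>M Q) {\<omega> \<in> space (P \<Otimes>\<^sub>M Q).
        \<bar>renyi_smooth \<alpha> d \<sigma> (emp n (fst \<omega>)) (emp n (snd \<omega>)) - renyi_smooth \<alpha> d \<sigma> M N\<bar> \<ge> thr}
      \<le> measure (P \<Otimes>\<^sub>M Q) (S1 \<times> space Q \<union> space P \<times> S2)"
  \<comment> \<open>Monotonicity asks for measurability of the larger set only, here a union of two
    measurable rectangles.\<close>
  proof (rule PQ.finite_measure_mono)
    show "S1 \<times> space Q \<union> space P \<times> S2 \<in> sets (P \<Otimes>\<^sub>M Q)"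
      using S1(1) S2(1) by (intro sets.Un pair_measureI) auto
  qed (use good in \<open>fastforce simp: space_pair_measure not_le[symmetric]\<close>)
  also have "\<dots> \<le> measure (P \<Otimes>\<^sub>M Q) (S1 \<times> space Q) + measure (P \<Otimes>\<^sub>M Q) (space P \<times> S2)"
    using S1(1) S2(1) by (intro measure_Un_le pair_measureI) auto
  also have "measure (P \<Otimes>\<^sub>M Q) (S1 \<times> space Q) = measure P S1"
    using S1(1) Q.emeasure_space_1 by (simp add: measure_def Q.emeasure_pair_measure_Times)
  also have "measure (P \<Otimes>\<^sub>M Q) (space P \<times> S2) = measure Q S2"
    using S2(1) P.emeasure_space_1 by (simp add: measure_def Q.emeasure_pair_measure_Times)
  also have "measure P S1 + measure Q S2 \<le> 2 * exp (- (real n * z\<^sup>2))"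
    using S1(2) S2(2) by simp
  finally show ?thesis
    unfolding ss thr_def .
qed

end

theorem theorem3:
  shows "\<exists>C>0. \<forall>(d::nat) (r::real) (\<sigma>::real) (\<alpha>::real) (n::nat) (z::real) M N.
     d \<ge> 1 \<longrightarrow> r \<ge> 0 \<longrightarrow> 0 < \<sigma> \<longrightarrow> \<sigma> \<le> 1 \<longrightarrow> 0 < \<alpha> \<longrightarrow> \<alpha> \<noteq> 1 \<longrightarrow>
     n \<ge> 1 \<longrightarrow> z \<ge> 0 \<longrightarrow> M \<in> prob_ball d r \<longrightarrow> N \<in> prob_ball d r \<longrightarrow>
     measure (sample_space n M N)
       {\<omega> \<in> space (sample_space n M N).
          \<bar>renyi_smooth \<alpha> d \<sigma> (emp n (fst \<omega>)) (emp n (snd \<omega>)) - renyi_smooth \<alpha> d \<sigma> M N\<bar>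
            \<ge> C * lambda_const \<alpha> d r \<sigma> * (xi_tilde r d \<sigma> / sqrt (real n) + z)}
     \<le> 2 * exp (- min (real n * z\<^sup>2) (real n * z))"
proof (intro exI[of _ "4 * exp 5"] conjI allI impI)
  fix d n :: nat and r \<sigma> \<alpha> z :: real and M N
  assume "d \<ge> 1" "r \<ge> 0" "0 < \<sigma>" and le: "\<sigma> \<le> 1" and "0 < \<alpha>" and *: "\<alpha> \<noteq> 1" "n \<ge> 1" "z \<ge> 0"
    "M \<in> prob_ball d r" "N \<in> prob_ball d r"
  then interpret smoothing d r \<sigma> \<alpha>
    by unfold_locales
  \<comment> \<open>The minimum is at most n z^2, so the subgaussian tail lies below the stated
    one.\<close>
  have "2 * exp (- (real n * z\<^sup>2)) \<le> 2 * exp (- min (real n * z\<^sup>2) (real n * z))"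
    by simp
  with renyi_concentration[OF le *]
  show "measure (sample_space n M N)
       {\<omega> \<in> space (sample_space n M N).
          \<bar>renyi_smooth \<alpha> d \<sigma> (emp n (fst \<omega>)) (emp n (snd \<omega>)) - renyi_smooth \<alpha> d \<sigma> M N\<bar>
            \<ge> 4 * exp 5 * lambda_const \<alpha> d r \<sigma> * (xi_tilde r d \<sigma> / sqrt (real n) + z)}
     \<le> 2 * exp (- min (real n * z\<^sup>2) (real n * z))"
    by (rule order_trans)
qed simp

end
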